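(* Let $\langle\Xi_n: n\ge0\rangle$ be a random walk on $\Gamma$, started at the identity $\mathbf o$, with $H(\Xi_1)<\infty$. Let $\mathcal I$ be the associated invariant $\sigma$-field and let $\mathcal J\subseteq\mathcal I$ be a $\Gamma$-closed sub-$\sigma$-field. Suppose that for each $\epsilon>0$ there is a random sequence $\langle Q_{n,\epsilon}: n\ge0\rangle$ of finite subsets of $\Gamma$ such that (i) $Q_{n,\epsilon}$ is $\mathcal J$-measurable; (ii) $\limsup_{n\to\infty}\frac1n\log|Q_{n,\epsilon}|<\epsilon$ almost surely; (iii) $\limsup_{n\to\infty}\mathbf P_{\mathbf o}[\exists m\ge n:\ \Xi_m\in Q_{n,\epsilon}]>0$. Then $\mathcal J=\mathcal I$ mod $0$.
   Context: $\Gamma$ is a countable infinite group with identity $\mathbf o$, and the random walk is the $\mu$-walk for a probability measure $\mu$ on $\Gamma$ whose support generates $\Gamma$ as a group: the Markov chain with transition probabilities $p(x,y)=\mu(x^{-1}y)$. $\mathbf P_{\mathbf o}$ is the law on the path space $\Gamma^{\mathbb N}$ ($\mathbb N\ni0$) of the trajectory started at $\mathbf o$, and $\Xi_n$ are the coordinate maps. $H(\Xi_1)=-\sum_x\mu(x)\log\mu(x)$ is the entropy of the law of $\Xi_1$. $\mathcal I$ is the $\sigma$-field of shift-invariant measurable subsets of $\Gamma^{\mathbb N}$. $\Gamma$ acts on $\Gamma^{\mathbb N}$ by diagonal left multiplication, hence on $\mathcal I$; a subset $\mathcal J\subseteq\mathcal I$ is $\Gamma$-closed if $\gamma(A)\in\mathcal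 J$ for all $\gamma\in\Gamma$ and $A\in\mathcal J$. Two $\sigma$-fields are equal mod $0$ if their completions with respect to $\mathbf P_{\mathbf o}$ are equal. The random sets $Q_{n,\epsilon}$ are functions on $\Gamma^{\mathbb N}$ with values in the (countable) collection of finite subsets of $\Gamma$; $\log 0=-\infty$. *)

theory Defs
  imports "HOL-Probability.Probability" "HOL-Algebra.Generated_Groups"
begin

definition path_space :: "('a, 'b) monoid_scheme \<Rightarrow> (nat \<Rightarrow> 'a) measure" where
  "path_space G = PiM UNIV (\<lambda>_. count_space (carrier G))"

definition transition_prob :: "('a, 'b) monoid_scheme \<Rightarrow> 'a pmf \<Rightarrow> 'a \<Rightarrow> 'a \<Rightarrow> real" where
  "transition_prob G \<mu> x y = pmf \<mu> (inv\<^bsub>G\<^esub> x \<otimes>\<^bsub>G\<^esub> y)"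

text \<open>\<open>P\<close> is the law on path space of the Markov chain with these transition probabilities,
  started at the identity; it is specified by its values on cylinders, which generate the
  \<open>\<sigma>\<close>-field of \<open>path_space G\<close> and form a \<open>\<pi>\<close>-system up to the empty set, so \<open>P\<close> is unique
  when \<open>carrier G\<close> is countable. Existence is proved below.\<close>

definition random_walk_law ::
  "('a, 'b) monoid_scheme \<Rightarrow> 'a pmf \<Rightarrow> (nat \<Rightarrow> 'a) measure \<Rightarrow> bool" where
  "random_walk_law G \<mu> P \<longleftrightarrow>
     prob_space P \<and> sets P = sets (path_space G) \<and>
     (\<forall>n x. (\<forall>i\<le>n. x i \<in> carrier G) \<longrightarrow>
        measure P {\<omega> \<in> space P. \<forall>i\<le>n. \<omega> i = x i} =
          (if x 0 = \<one>\<^bsub>G\<^esub> then (\<Prod>i<n. transition_prob G \<mu> (x i) (x (Suc i))) else 0))"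

text \<open>The terms are nonnegative because \<open>pmf \<mu> x \<le> 1\<close>, and \<open>0 * ln 0 = 0\<close>.\<close>

definition pmf_entropy :: "'a pmf \<Rightarrow> ennreal" where
  "pmf_entropy \<mu> = (\<integral>\<^sup>+ x. ennreal (- (pmf \<mu> x * ln (pmf \<mu> x))) \<partial>count_space UNIV)"

definition path_shift :: "(nat \<Rightarrow> 'a) \<Rightarrow> nat \<Rightarrow> 'a" where
  "path_shift \<omega> = (\<lambda>n. \<omega> (Suc n))"

definition invariant_sets :: "('a, 'b) monoid_scheme \<Rightarrow> (nat \<Rightarrow> 'a) set set" where
  "invariant_sets G =
     {A \<in> sets (path_space G). path_shift -` A \<inter> space (path_space G) = A}"

definition path_translate :: "('a, 'b) monoid_scheme \<Rightarrow> 'a \<Rightarrow> (nat \<Rightarrow> 'a) \<Rightarrow> nat \<Rightarrow> 'a" where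
  "path_translate G \<gamma> \<omega> = (\<lambda>n. \<gamma> \<otimes>\<^bsub>G\<^esub> \<omega> n)"

definition group_closed :: "('a, 'b) monoid_scheme \<Rightarrow> (nat \<Rightarrow> 'a) set set \<Rightarrow> bool" where
  "group_closed G J \<longleftrightarrow> (\<forall>\<gamma>\<in>carrier G. \<forall>A\<in>J. path_translate G \<gamma> ` A \<in> J)"

text \<open>The completion of a sub-\<open>\<sigma>\<close>-field \<open>F\<close> with respect to \<open>M\<close> adjoins all subsets of
  \<open>M\<close>-null sets, not only the subsets of null sets that lie in \<open>F\<close>. With the latter convention
  the trivial \<open>\<sigma>\<close>-field would be its own completion.\<close>

definition completed_sets :: "'a measure \<Rightarrow> 'a set set \<Rightarrow> 'a set set" where
  "completed_sets M F = sigma_sets (space M) (F \<union> null_sets (completion M))"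

definition equal_mod0 :: "'a measure \<Rightarrow> 'a set set \<Rightarrow> 'a set set \<Rightarrow> bool" where
  "equal_mod0 M F F' \<longleftrightarrow> completed_sets M F = completed_sets M F'"

text \<open>The real function \<open>ln\<close> has the value \<open>0\<close> at \<open>0\<close>; here \<open>log 0 = -\<infinity>\<close>.\<close>

definition log_card :: "'a set \<Rightarrow> ereal" where
  "log_card A = (if card A = 0 then -\<infinity> else ereal (ln (real (card A))))"

lemma random_walk_law_exists:
  assumes "group G" and count: "countable (carrier G)" and supp: "set_pmf \<mu> \<subseteq> carrier G"
  shows "\<exists>P. random_walk_law G \<mu> P"
proof -
  interpret group G by fact
  define f where "f y = (if y \<in> carrier G then y else \<one>\<^bsub>G\<^esub>)" for y
  define S where "S = (\<lambda>(\<xi>::nat \<Rightarrow> 'a) n. rec_nat \<one>\<^bsub>G\<^esub> (\<lambda>k y. y \<otimes>\<^bsub>G\<^esub> f (\<xi> k)) n)"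
  define M where "M = PiM (UNIV::nat set) (\<lambda>_. measure_pmf \<mu>)"
  interpret PP: product_prob_space "\<lambda>_::nat. measure_pmf \<mu>" UNIV
    by unfold_locales
  have M_prob: "prob_space M"
    unfolding M_def by (intro prob_space_PiM measure_pmf.prob_space_axioms)
  have f: "f y \<in> carrier G" for y
    by (simp add: f_def)
  have S0: "S \<xi> 0 = \<one>\<^bsub>G\<^esub>" and SS: "S \<xi> (Suc n) = S \<xi> n \<otimes>\<^bsub>G\<^esub> f (\<xi> n)" for \<xi> n
    by (simp_all add: S_def)
  have S_carrier: "S \<xi> n \<in> carrier G" for \<xi> n
    by (induction n) (simp_all add: S0 SS f)
  have coord: "(\<lambda>\<xi>. \<xi> n) \<in> measurable M (count_space UNIV)" for n
  proof -
    have "(\<lambda>\<xi>. \<xi> n) \<in> measurable M (measure_pmf \<mu>)"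
      unfolding M_def by (rule measurable_component_singleton) simp
    moreover have "measurable M (measure_pmf \<mu>) = measurable M (count_space UNIV)"
      by (rule measurable_cong_sets) simp_all
    ultimately show ?thesis by simp
  qed
  have S_meas: "(\<lambda>\<xi>. S \<xi> n) \<in> measurable M (count_space (carrier G))" for n
  proof (induction n)
    case (Suc n)
    have step: "(\<lambda>\<xi>. i \<otimes>\<^bsub>G\<^esub> f (\<xi> n)) \<in> measurable M (count_space (carrier G))"
      if "i \<in> carrier G" for i
      using that f by (intro measurable_compose[OF coord]) (auto simp: measurable_count_space_eq1)
    show ?case
      unfolding SS by (rule measurable_compose_countable'[OF step Suc count])
  qed (simp add: S0)
  have S_path: "S \<in> measurable M (path_space G)"
    unfolding path_space_def using S_meas
    by (intro measurable_PiM_single') (auto simp: S_carrier)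
  define P where "P = distr M (path_space G) S"
  have cylinder: "measure P {\<omega> \<in> space P. \<forall>i\<le>n. \<omega> i = x i} =
          (if x 0 = \<one>\<^bsub>G\<^esub> then (\<Prod>i<n. transition_prob G \<mu> (x i) (x (Suc i))) else 0)"
    if x: "\<forall>i\<le>n. x i \<in> carrier G" for n x
  proof -
    have "{\<omega> \<in> space (path_space G). \<forall>i\<le>n. \<omega> i = x i} \<in> sets (path_space G)"
    proof -
      have "(\<lambda>\<omega>. \<omega> i) \<in> measurable (path_space G) (count_space (carrier G))" for i
        unfolding path_space_def by (rule measurable_component_singleton) simp
      then have "{\<omega> \<in> space (path_space G). \<omega> i = x i} \<in> sets (path_space G)" if "i \<le> n" for i
        using measurable_sets[of "\<lambda>\<omega>. \<omega> i" "path_space G" "count_space (carrier G)" "{x i}"] that x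
        by (simp add: vimage_def Int_def conj_commute)
      then show ?thesis
        using sets.sets_Collect_finite_All'[of "{..n}" "path_space G" "\<lambda>i \<omega>. \<omega> i = x i"]
        by (simp add: Ball_def)
    qed
    then have "measure P {\<omega> \<in> space P. \<forall>i\<le>n. \<omega> i = x i} =
        measure M (S -` {\<omega> \<in> space (path_space G). \<forall>i\<le>n. \<omega> i = x i} \<inter> space M)"
      unfolding P_def space_distr by (rule measure_distr[OF S_path])
    also have "S -` {\<omega> \<in> space (path_space G). \<forall>i\<le>n. \<omega> i = x i} \<inter> space M =
        {\<xi> \<in> space M. \<forall>i\<le>n. S \<xi> i = x i}"
      using measurable_space[OF S_path] by auto
    also have "measure M \<dots> =
        (if x 0 = \<one>\<^bsub>G\<^esub> then (\<Prod>i<n. transition_prob G \<mu> (x i) (x (Suc i))) else 0)"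
    proof (cases "x 0 = \<one>\<^bsub>G\<^esub>")
      case True
      define B where "B i = {y. f y = inv\<^bsub>G\<^esub> x i \<otimes>\<^bsub>G\<^esub> x (Suc i)}" for i
      have "(\<forall>i\<le>m. S \<xi> i = x i) \<longleftrightarrow> (\<forall>i<m. \<xi> i \<in> B i)" if "m \<le> n" for \<xi> m
        using that
      proof (induction m)
        case (Suc m)
        then have IH: "(\<forall>i\<le>m. S \<xi> i = x i) \<longleftrightarrow> (\<forall>i<m. \<xi> i \<in> B i)"
          and c: "x m \<in> carrier G" "x (Suc m) \<in> carrier G"
          using x by auto
        have "S \<xi> (Suc m) = x (Suc m) \<longleftrightarrow> \<xi> m \<in> B m" if "S \<xi> m = x m"
          using c f that by (auto simp: SS B_def inv_solve_left inv_solve_left')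
        then show ?case
          using IH by (auto simp: le_Suc_eq less_Suc_eq)
      qed (simp add: S0 True)
      then have "{\<xi> \<in> space M. \<forall>i\<le>n. S \<xi> i = x i} =
          {\<xi> \<in> space (PiM UNIV (\<lambda>_. measure_pmf \<mu>)). \<forall>i\<in>{..<n}. \<xi> i \<in> B i}"
        by (auto simp: M_def)
      then have "emeasure M {\<xi> \<in> space M. \<forall>i\<le>n. S \<xi> i = x i} =
          (\<Prod>i<n. emeasure (measure_pmf \<mu>) (B i))"
        unfolding M_def by (simp only:) (rule PP.emeasure_PiM_Collect, auto)
      also have "\<dots> = (\<Prod>i<n. ennreal (transition_prob G \<mu> (x i) (x (Suc i))))"
      proof (rule prod.cong[OF refl])
        fix i assume "i \<in> {..<n}"
        then have c: "inv\<^bsub>G\<^esub> x i \<otimes>\<^bsub>G\<^esub> x (Suc i) \<in> carrier G"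
          using x by auto
        have "emeasure (measure_pmf \<mu>) (B i) =
            emeasure (measure_pmf \<mu>) {inv\<^bsub>G\<^esub> x i \<otimes>\<^bsub>G\<^esub> x (Suc i)}"
          using supp c
          by (intro emeasure_eq_AE) (auto simp: AE_measure_pmf_iff B_def f_def subset_eq)
        then show "emeasure (measure_pmf \<mu>) (B i) =
            ennreal (transition_prob G \<mu> (x i) (x (Suc i)))"
          by (simp add: transition_prob_def emeasure_pmf_single)
      qed
      also have "\<dots> = ennreal (\<Prod>i<n. transition_prob G \<mu> (x i) (x (Suc i)))"
        by (rule prod_ennreal) (simp add: transition_prob_def)
      finally show ?thesis
        using True by (simp add: measure_def prod_nonneg transition_prob_def)
    next
      case False
      then have "{\<xi> \<in> space M. \<forall>i\<le>n. S \<xi> i = x i} = {}"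
        by (auto simp: S0 intro!: exI[of _ 0])
      then show ?thesis
        using False by (simp only: measure_empty if_False)
    qed
    finally show ?thesis .
  qed
  have "prob_space P"
    unfolding P_def by (rule prob_space.prob_space_distr[OF M_prob S_path])
  then have "random_walk_law G \<mu> P"
    using cylinder by (simp add: random_walk_law_def P_def)
  then show ?thesis ..
qed

end

theory Submission
  imports Defs
begin

text \<open>
For \<open>x\<close> reached by the walk, the law of the walk started at \<open>x\<close> has on \<open>J\<close> a density
\<open>f\<^sub>x\<^bsup>J\<^esup>\<close> with respect to \<open>P\<close>, and \<open>P(X\<^sub>m = x | J) = P(X\<^sub>m = x) f\<^sub>x\<^bsup>J\<^esup>\<close>; the same holds for the full
invariant \<open>\<sigma>\<close>-field \<open>I\<close>, where this probability is at most 1. Hence \<open>P(X\<^sub>m | J)\<close> is at most the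
ratio \<open>f\<^bsup>J\<^esup>/f\<^bsup>I\<^esup>\<close> at \<open>X\<^sub>m\<close>. The densities are multiplicative cocycles, so this ratio is a product of
a stationary ergodic sequence \<open>u\<^sub>k\<close> with \<open>E u \<le> 1\<close>. Unless \<open>u = 1\<close> almost surely,
\<open>E (1 - sqrt u) > 0\<close>, and the maximal ergodic theorem shows that \<open>P(X\<^sub>m | J)\<close> decays exponentially.
Then a \<open>J\<close>-measurable random set of size \<open>e\<^bsup>\<epsilon>n\<^esup>\<close>, with \<open>\<epsilon>\<close> small, meets the trajectory after time
\<open>n\<close> with probability at most a geometric tail, which contradicts (iii). So \<open>u = 1\<close>, that is,
\<open>f\<^bsup>J\<^esup> = f\<^bsup>I\<^esup>\<close>, and then the conditional expectation given \<open>J\<close> of the indicator of an invariant set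
has the same integral over every cylinder as the indicator itself.
\<close>

section \<open>Path space\<close>

lemma space_path_space: "space (path_space G) = {\<omega>. \<forall>n. \<omega> n \<in> carrier G}"
  by (auto simp: path_space_def space_PiM)

lemma measurable_path_coord [measurable]:
  "(\<lambda>\<omega>. \<omega> n) \<in> measurable (path_space G) (count_space (carrier G))"
  unfolding path_space_def by (rule measurable_component_singleton) simp

lemma measurable_path_spaceI:
  assumes "\<And>n. (\<lambda>z. f z n) \<in> measurable M (count_space (carrier G))"
  shows "f \<in> measurable M (path_space G)"
  unfolding path_space_def using assms
  by (intro measurable_PiM_single') (auto dest: measurable_space[OF assms])

section \<open>Cylinders as a generating family\<close>

definition cylinder :: "('a, 'b) monoid_scheme \<Rightarrow> nat \<Rightarrow> (nat \<Rightarrow> 'a) \<Rightarrow> (nat \<Rightarrow> 'a) set" where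
  "cylinder G n x = {\<omega> \<in> space (path_space G). \<forall>i\<le>n. \<omega> i = x i}"

lemma sets_path_coord [measurable]:
  "{\<omega> \<in> space (path_space G). \<omega> n = a} \<in> sets (path_space G)"
proof (cases "a \<in> carrier G")
  case True
  have "(\<lambda>\<omega>. \<omega> n) -` {a} \<inter> space (path_space G) \<in> sets (path_space G)"
    by (rule measurable_sets[OF measurable_path_coord]) (use True in auto)
  then show ?thesis by (simp add: vimage_def Int_def conj_commute)
next
  case False
  then have "{\<omega> \<in> space (path_space G). \<omega> n = a} = {}"
    by (auto simp: space_path_space)
  then show ?thesis by (simp only: sets.empty_sets)
qed

lemma sets_cylinder [measurable]: "cylinder G n x \<in> sets (path_space G)"
proof -
  have "cylinder G n x = (\<Inter>i\<in>{..n}. {\<omega> \<in> space (path_space G). \<omega> i = x i})"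
    by (auto simp: cylinder_def)
  also have "\<dots> \<in> sets (path_space G)"
    by (intro sets.finite_INT) auto
  finally show ?thesis .
qed

text \<open>A cylinder prescribes a whole prefix, so an event at a single time is split over the
  prefixes compatible with it. The prefixes are extensional on \<open>{..m}\<close>: this makes the
  index set countable and gives disjoint cylinders for distinct indices.\<close>

lemma path_coord_eq_UN_cylinder:
  assumes "n \<le> m"
  shows "{\<omega> \<in> space (path_space G). \<omega> n = a} =
    (\<Union>y\<in>{y \<in> {..m} \<rightarrow>\<^sub>E carrier G. y n = a}. cylinder G m y)"
proof (intro equalityI subsetI)
  fix \<omega> assume "\<omega> \<in> {\<omega> \<in> space (path_space G). \<omega> n = a}"
  then show "\<omega> \<in> (\<Union>y\<in>{y \<in> {..m} \<rightarrow>\<^sub>E carrier G. y n = a}. cylinder G m y)"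
    using assms
    by (intro UN_I[of "restrict \<omega> {..m}"]) (auto simp: cylinder_def space_path_space)
qed (use assms in \<open>auto simp: cylinder_def\<close>)

lemma countable_prefixes:
  assumes "countable (carrier G)"
  shows "countable {y \<in> {..m::nat} \<rightarrow>\<^sub>E carrier G. y n = a}"
  by (rule countable_subset[OF _ countable_PiE[of "{..m}" "\<lambda>_. carrier G"]]) (use assms in auto)

lemma disjoint_prefix_cylinders:
  "disjoint_family_on (cylinder G m) {y \<in> {..m} \<rightarrow>\<^sub>E carrier G. Q y}"
proof (unfold disjoint_family_on_def, intro ballI impI)
  fix y z assume yz: "y \<in> {y \<in> {..m} \<rightarrow>\<^sub>E carrier G. Q y}" "z \<in> {y \<in> {..m} \<rightarrow>\<^sub>E carrier G. Q y}" "y \<noteq> z"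
  then obtain i where "y i \<noteq> z i" by blast
  moreover have "i \<le> m"
    using yz calculation by (cases "i \<le> m") (auto simp: PiE_def extensional_def)
  ultimately show "cylinder G m y \<inter> cylinder G m z = {}"
    by (auto simp: cylinder_def)
qed

text \<open>Together with the empty set the cylinders form a generating pi-system, and countably
  many cylinders at time 0 cover the space. Independence, ergodicity and the final identification of
  conditional expectations are all reduced to cylinders this way.\<close>

lemma measure_eqI_cylinder:
  assumes count: "countable (carrier G)"
    and sets: "sets M = sets (path_space G)" "sets N = sets (path_space G)"
    and fin: "finite_measure M"
    and eq: "\<And>n x. (\<forall>i\<le>n. x i \<in> carrier G) \<Longrightarrow>
      emeasure M (cylinder G n x) = emeasure N (cylinder G n x)"
  shows "M = N"
proof -
  let ?S = "space (path_space G)"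
  define E where "E = insert {} {cylinder G n x | n x. \<forall>i\<le>n. x i \<in> carrier G}"
  have E_sets: "E \<subseteq> sets (path_space G)"
    by (auto simp: E_def)
  \<comment> \<open>Two cylinders are nested or disjoint, according to whether their prefixes agree
    up to the shorter length.\<close>
  have cyl_Int: "cylinder G m x \<inter> cylinder G n y \<in> E"
    if x: "\<forall>i\<le>m. x i \<in> carrier G" and y: "\<forall>i\<le>n. y i \<in> carrier G" and mn: "m \<le> n" for m n x y
  proof (cases "\<forall>i\<le>m. x i = y i")
    case True
    then have "cylinder G m x \<inter> cylinder G n y = cylinder G n y"
      using mn by (auto simp: cylinder_def)
    then show ?thesis using y by (auto simp: E_def)
  next
    case False
    then have "cylinder G m x \<inter> cylinder G n y = {}"
      using mn by (force simp: cylinder_def)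
    then show ?thesis by (simp add: E_def)
  qed
  have "Int_stable E"
  proof (rule Int_stableI)
    fix a b assume "a \<in> E" "b \<in> E"
    then consider "a = {} \<or> b = {}" |
      m x n y where "a = cylinder G m x" "b = cylinder G n y"
        "\<forall>i\<le>m. x i \<in> carrier G" "\<forall>i\<le>n. y i \<in> carrier G"
      by (auto simp: E_def)
    then show "a \<inter> b \<in> E"
    proof cases
      case 2
      then show ?thesis
        using cyl_Int[of m x n y] cyl_Int[of n y m x] by (cases "m \<le> n") (auto simp: Int_commute)
    qed (auto simp: E_def)
  qed
  moreover have gen: "sigma_sets ?S E = sets (path_space G)"
  proof
    show "sigma_sets ?S E \<subseteq> sets (path_space G)"
      using sets.sigma_sets_subset[OF E_sets] .
    have Epow: "E \<subseteq> Pow ?S" using E_sets sets.space_closed by blast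
    \<comment> \<open>The product field is the smallest one for which all coordinates are
      measurable, so the reverse inclusion amounts to measurability of the identity map out of the
      generated field.\<close>
    have "(\<lambda>\<omega>. \<omega>) \<in> measurable (sigma ?S E) (path_space G)"
    proof (rule measurable_path_spaceI)
      fix n
      have "(\<lambda>\<omega>. \<omega> n) -` {a} \<inter> space (sigma ?S E) \<in> sets (sigma ?S E)" for a
      proof -
        have "(\<lambda>\<omega>. \<omega> n) -` {a} \<inter> space (sigma ?S E) = {\<omega> \<in> ?S. \<omega> n = a}"
          using Epow by auto
        also have "\<dots> = (\<Union>y\<in>{y \<in> {..n} \<rightarrow>\<^sub>E carrier G. y n = a}. cylinder G n y)"
          by (rule path_coord_eq_UN_cylinder) simp
        also have "\<dots> \<in> sets (sigma ?S E)"
          using Epow by (intro sets.countable_UN'' countable_prefixes count)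
            (auto simp: E_def intro!: sigma_sets.Basic exI[of _ n])
        finally show ?thesis .
      qed
      then show "(\<lambda>\<omega>. \<omega> n) \<in> measurable (sigma ?S E) (count_space (carrier G))"
        using count Epow by (subst measurable_count_space_eq_countable)
          (auto simp: space_path_space)
    qed
    then have "A \<inter> ?S \<in> sigma_sets ?S E" if "A \<in> sets (path_space G)" for A
      using measurable_sets[of "\<lambda>\<omega>. \<omega>" "sigma ?S E" "path_space G" A] that Epow by simp
    then show "sets (path_space G) \<subseteq> sigma_sets ?S E"
      by (metis sets.Int_space_eq2 subsetI)
  qed
  ultimately show ?thesis
  proof (intro measure_eqI_generator_eq_countable[where E = E and \<Omega> = ?S and
        A = "(\<lambda>a. cylinder G 0 (\<lambda>_. a)) ` carrier G"])
    show "E \<subseteq> Pow ?S" using E_sets sets.space_closed by blast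
    show "\<Union> ((\<lambda>a. cylinder G 0 (\<lambda>_. a)) ` carrier G) = ?S"
      by (auto simp: cylinder_def space_path_space)
    show "emeasure M X = emeasure N X" if "X \<in> E" for X
      using that eq by (auto simp: E_def)
    show "emeasure M a \<noteq> \<infinity>" for a
      using finite_measure.emeasure_finite[OF fin] by simp
  qed (use sets gen count in \<open>auto simp: E_def\<close>)
qed

section \<open>The Markov property and ergodicity of the increments\<close>

locale random_walk = group G for G :: "('a, 'b) monoid_scheme" (structure) +
  fixes \<mu> :: "'a pmf" and P :: "(nat \<Rightarrow> 'a) measure"
  assumes countable_carrier: "countable (carrier G)"
    and law: "random_walk_law G \<mu> P"
begin

lemma prob_space_P: "prob_space P"
  using law by (simp add: random_walk_law_def)

sublocale prob_space P
  by (rule prob_space_P)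

lemma sets_P [measurable_cong, simp]: "sets P = sets (path_space G)"
  using law by (simp add: random_walk_law_def)

lemma space_P [simp]: "space P = space (path_space G)"
  by (rule sets_eq_imp_space_eq) simp

lemma prob_path_space [simp]: "prob (space (path_space G)) = 1"
  using prob_space by simp

lemma emeasure_cylinder:
  assumes "\<forall>i\<le>n. x i \<in> carrier G"
  shows "emeasure P (cylinder G n x) =
    ennreal (if x 0 = \<one> then (\<Prod>i<n. transition_prob G \<mu> (x i) (x (Suc i))) else 0)"
proof -
  have "measure P {\<omega> \<in> space P. \<forall>i\<le>n. \<omega> i = x i} =
      (if x 0 = \<one> then (\<Prod>i<n. transition_prob G \<mu> (x i) (x (Suc i))) else 0)"
    using law assms by (auto simp: random_walk_law_def)
  then show ?thesis
    by (simp add: emeasure_eq_measure cylinder_def)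
qed

lemma AE_start: "AE \<omega> in P. \<omega> 0 = \<one>"
proof -
  have "emeasure P (cylinder G 0 (\<lambda>_. \<one>)) = 1"
    by (subst emeasure_cylinder) auto
  then have "prob {\<omega> \<in> space P. \<omega> 0 = \<one>} = 1"
    by (simp add: cylinder_def emeasure_eq_measure)
  then show ?thesis
    by (subst (asm) prob_Collect_eq_1) auto
qed

text \<open>The walk built from the increments after time \<open>m\<close>. Unlike the plain shift,
  this operation preserves the law of the walk, so it carries the ergodic theory.
  \<open>recentre 0\<close> divides by the starting point and is the identity only almost surely;
  later formulas therefore keep it explicit.\<close>

definition recentre :: "nat \<Rightarrow> (nat \<Rightarrow> 'a) \<Rightarrow> nat \<Rightarrow> 'a" where
  "recentre m \<omega> = (\<lambda>n. inv (\<omega> m) \<otimes> \<omega> (m + n))"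

lemma recentre_in_space: "\<omega> \<in> space (path_space G) \<Longrightarrow> recentre m \<omega> \<in> space (path_space G)"
  by (simp add: recentre_def space_path_space)

lemma measurable_recentre [measurable]: "recentre m \<in> measurable (path_space G) (path_space G)"
proof (rule measurable_path_spaceI)
  fix n
  have "(\<lambda>\<omega>. inv x \<otimes> \<omega> (m + n)) \<in> measurable (path_space G) (count_space (carrier G))"
    if "x \<in> carrier G" for x
    using that by (intro measurable_compose[OF measurable_path_coord]) auto
  then show "(\<lambda>\<omega>. recentre m \<omega> n) \<in> measurable (path_space G) (count_space (carrier G))"
    unfolding recentre_def
    by (rule measurable_compose_countable'[OF _ measurable_path_coord countable_carrier])
qed

lemma recentre_recentre:
  assumes "\<omega> \<in> space (path_space G)"
  shows "recentre k (recentre m \<omega>) = recentre (m + k) \<omega>"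
proof
  fix n
  have "\<omega> i \<in> carrier G" for i using assms by (simp add: space_path_space)
  then show "recentre k (recentre m \<omega>) n = recentre (m + k) \<omega> n"
    by (simp add: recentre_def inv_mult_group m_assoc inv_solve_left add.assoc)
       (simp add: m_assoc[symmetric])
qed

text \<open>Events of the first \<open>m\<close> steps enter only through their independence of the recentred future;
  in this form the notion is closed under countable disjoint unions.\<close>

definition past :: "nat \<Rightarrow> (nat \<Rightarrow> 'a) set \<Rightarrow> bool" where
  "past m B \<longleftrightarrow> B \<in> sets (path_space G) \<and>
     (\<forall>E\<in>sets (path_space G). emeasure P (B \<inter> (recentre m -` E \<inter> space P)) =
        emeasure P B * emeasure P E)"

text \<open>Transition probabilities are invariant under left multiplication, so the probability of
  a prefix continued by a translated prefix factors. Both sides of the independence are measures in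
  the future event, so testing cylinders suffices.\<close>

lemma past_cylinder:
  assumes x: "\<forall>i\<le>m. x i \<in> carrier G"
  shows "past m (cylinder G m x)"
proof -
  let ?C = "cylinder G m x"
  define t where "t = transition_prob G \<mu>"
  have t_nonneg: "0 \<le> t a b" for a b by (simp add: t_def transition_prob_def)
  have t_mult: "t (a \<otimes> b) (a \<otimes> c) = t b c" if "a \<in> carrier G" "b \<in> carrier G" "c \<in> carrier G" for a b c
  proof -
    have "inv (a \<otimes> b) \<otimes> (a \<otimes> c) = inv b \<otimes> c"
      using that by (simp add: inv_mult_group m_assoc) (simp add: m_assoc[symmetric])
    then show ?thesis by (simp add: t_def transition_prob_def)
  qed
  have "distr (density P (indicator ?C)) (path_space G) (recentre m) =
      scale_measure (emeasure P ?C) P" (is "?L = ?R")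
  proof (rule measure_eqI_cylinder[OF countable_carrier])
    show "finite_measure ?L"
    proof (rule finite_measure.finite_measure_distr)
      show "finite_measure (density P (indicator ?C))"
        by (rule finite_measure_restricted) simp
    qed measurable
    fix n and y :: "nat \<Rightarrow> 'a" assume y: "\<forall>i\<le>n. y i \<in> carrier G"
    \<comment> \<open>The prefix \<open>y\<close> is translated to start at \<open>x m\<close> and
      glued to \<open>x\<close>. Time \<open>m\<close> belongs to both pieces, and they agree there
      exactly when \<open>y 0\<close> is the identity.\<close>
    define z where "z i = (if i \<le> m then x i else x m \<otimes> y (i - m))" for i
    have z: "\<forall>i\<le>m+n. z i \<in> carrier G"
      using x y by (auto simp: z_def)
    have "emeasure ?L (cylinder G n y) =
        emeasure P (?C \<inter> (recentre m -` cylinder G n y \<inter> space P))"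
      by (subst emeasure_distr) (simp_all add: emeasure_restricted)
    also have "\<dots> = emeasure P ?C * emeasure P (cylinder G n y)"
    proof (cases "y 0 = \<one>")
      case True
      have "?C \<inter> (recentre m -` cylinder G n y \<inter> space P) = cylinder G (m + n) z"
      proof (intro equalityI subsetI)
        fix \<omega> assume \<omega>: "\<omega> \<in> ?C \<inter> (recentre m -` cylinder G n y \<inter> space P)"
        then have c: "\<omega> i \<in> carrier G" for i by (simp add: space_path_space)
        have "\<omega> i = z i" if "i \<le> m + n" for i
        proof (cases "i \<le> m")
          case False
          have "\<forall>j\<le>n. recentre m \<omega> j = y j"
            using \<omega> by (simp add: cylinder_def)
          then have "recentre m \<omega> (i - m) = y (i - m)"
            using that by simp
          then have "inv (\<omega> m) \<otimes> \<omega> i = y (i - m)"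
            using False by (simp add: recentre_def)
          then show ?thesis
            using False c \<omega> x y that by (auto simp: z_def cylinder_def inv_solve_left')
        qed (use \<omega> in \<open>simp add: z_def cylinder_def\<close>)
        then show "\<omega> \<in> cylinder G (m + n) z"
          using \<omega> by (simp add: cylinder_def)
      next
        fix \<omega> assume \<omega>: "\<omega> \<in> cylinder G (m + n) z"
        then have c: "\<omega> i \<in> carrier G" for i by (simp add: cylinder_def space_path_space)
        have C: "\<omega> \<in> ?C" using \<omega> by (auto simp: cylinder_def z_def)
        have "inv (\<omega> m) \<otimes> \<omega> (m + j) = y j" if "j \<le> n" for j
        proof -
          have "\<omega> (m + j) = x m \<otimes> y j"
            using \<omega> that True x by (cases "j = 0") (auto simp: cylinder_def z_def)
          moreover have "\<omega> m = x m" using C by (simp add: cylinder_def)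
          ultimately show ?thesis using x y that by (simp add: m_assoc[symmetric])
        qed
        then show "\<omega> \<in> ?C \<inter> (recentre m -` cylinder G n y \<inter> space P)"
          using C \<omega> recentre_in_space[of \<omega> m] by (auto simp: cylinder_def recentre_def)
      qed
      moreover have "(\<Prod>i<m+n. t (z i) (z (Suc i))) =
          (\<Prod>i<m. t (x i) (x (Suc i))) * (\<Prod>i<n. t (y i) (y (Suc i)))"
      proof -
        have "(\<Prod>i<m+n. t (z i) (z (Suc i))) =
            (\<Prod>i<m. t (z i) (z (Suc i))) * (\<Prod>j<n. t (z (m + j)) (z (Suc (m + j))))"
          by (induction n) (simp_all add: mult.assoc)
        moreover have "(\<Prod>i<m. t (z i) (z (Suc i))) = (\<Prod>i<m. t (x i) (x (Suc i)))"
          by (rule prod.cong) (auto simp: z_def)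
        moreover have "(\<Prod>j<n. t (z (m + j)) (z (Suc (m + j)))) = (\<Prod>j<n. t (y j) (y (Suc j)))"
        proof (rule prod.cong[OF refl])
          fix j assume "j \<in> {..<n}"
          moreover have "z (m + j) = x m \<otimes> y j"
            using True x by (auto simp: z_def)
          ultimately show "t (z (m + j)) (z (Suc (m + j))) = t (y j) (y (Suc j))"
            using x y t_mult by (simp add: z_def)
        qed
        ultimately show ?thesis by simp
      qed
      ultimately show ?thesis
        using x y z True t_nonneg
        by (simp add: emeasure_cylinder z_def[of 0] t_def[symmetric] ennreal_mult prod_nonneg)
    next
      case False
      \<comment> \<open>A recentred path always starts at the identity, and so does
        \<open>P\<close>-almost every path; both sides vanish for such a \<open>y\<close>.\<close>
      have "?C \<inter> (recentre m -` cylinder G n y \<inter> space P) = {}"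
        using False by (force simp: cylinder_def recentre_def space_path_space)
      then show ?thesis
        using False y by (simp only: emeasure_cylinder[OF y]) simp
    qed
    finally show "emeasure ?L (cylinder G n y) = emeasure ?R (cylinder G n y)"
      by (simp add: emeasure_scale_measure)
  qed simp_all
  note LR = this
  have "emeasure P (?C \<inter> (recentre m -` E \<inter> space P)) = emeasure P ?C * emeasure P E"
    if "E \<in> sets (path_space G)" for E
  proof -
    have "emeasure P (?C \<inter> (recentre m -` E \<inter> space P)) = emeasure ?L E"
      using that by (subst emeasure_distr) (simp_all add: emeasure_restricted measurable_sets)
    then show ?thesis using LR by (simp add: emeasure_scale_measure)
  qed
  then show ?thesis by (simp add: past_def)
qed

lemma past_UN:
  assumes I: "countable I" and disj: "disjoint_family_on B I" and B: "\<And>i. i \<in> I \<Longrightarrow> past m (B i)"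
  shows "past m (\<Union>i\<in>I. B i)"
proof -
  have [measurable]: "B i \<in> sets (path_space G)" if "i \<in> I" for i
    using B[OF that] by (simp add: past_def)
  have "emeasure P ((\<Union>i\<in>I. B i) \<inter> (recentre m -` E \<inter> space P)) =
      emeasure P (\<Union>i\<in>I. B i) * emeasure P E" if [measurable]: "E \<in> sets (path_space G)" for E
  proof -
    let ?E = "recentre m -` E \<inter> space P"
    have "?E \<in> sets P" by measurable
    then have "emeasure P (\<Union>i\<in>I. B i \<inter> ?E) = (\<integral>\<^sup>+i. emeasure P (B i \<inter> ?E) \<partial>count_space I)"
      using disj I by (intro emeasure_UN_countable) (auto simp: disjoint_family_on_def)
    also have "\<dots> = (\<integral>\<^sup>+i. emeasure P (B i) * emeasure P E \<partial>count_space I)"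
      using B by (intro nn_integral_cong) (auto simp: past_def)
    also have "\<dots> = emeasure P (\<Union>i\<in>I. B i) * emeasure P E"
      using I disj by (simp add: nn_integral_multc emeasure_UN_countable)
    finally show ?thesis by (simp add: Int_UN_distrib2 Int_commute)
  qed
  then show ?thesis
    using I by (auto simp: past_def)
qed

lemma past_position: "past m {\<omega> \<in> space P. \<omega> m = x}"
  unfolding space_P path_coord_eq_UN_cylinder[OF le_refl]
  by (intro past_UN countable_prefixes countable_carrier disjoint_prefix_cylinders past_cylinder) auto

lemma past_space: "past m (space P)"
proof -
  have "past m (\<Union>x\<in>carrier G. {\<omega> \<in> space P. \<omega> m = x})"
    by (intro past_UN countable_carrier past_position) (auto simp: disjoint_family_on_def)
  also have "(\<Union>x\<in>carrier G. {\<omega> \<in> space P. \<omega> m = x}) = space P"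
    by (auto simp: space_path_space)
  finally show ?thesis .
qed

lemma nn_integral_past:
  assumes B: "past m B" and [measurable]: "h \<in> borel_measurable (path_space G)"
  shows "(\<integral>\<^sup>+\<omega>. indicator B \<omega> * h (recentre m \<omega>) \<partial>P) = emeasure P B * (\<integral>\<^sup>+\<omega>. h \<omega> \<partial>P)"
proof -
  have [measurable]: "B \<in> sets (path_space G)" using B by (simp add: past_def)
  have "distr (density P (indicator B)) (path_space G) (recentre m) = scale_measure (emeasure P B) P"
  proof (rule measure_eqI)
    fix E assume "E \<in> sets (distr (density P (indicator B)) (path_space G) (recentre m))"
    then have [measurable]: "E \<in> sets (path_space G)" by simp
    have "recentre m -` E \<inter> space P \<in> sets P" by measurable
    then have "emeasure (density P (indicator B)) (recentre m -` E \<inter> space P) = emeasure P B * emeasure P E"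
      using B by (simp add: emeasure_restricted past_def)
    then show "emeasure (distr (density P (indicator B)) (path_space G) (recentre m)) E =
        emeasure (scale_measure (emeasure P B) P) E"
      by (subst emeasure_distr) (simp_all add: emeasure_scale_measure)
  qed simp
  then have "(\<integral>\<^sup>+\<omega>. h \<omega> \<partial>distr (density P (indicator B)) (path_space G) (recentre m)) =
      emeasure P B * (\<integral>\<^sup>+\<omega>. h \<omega> \<partial>P)"
    by (simp add: nn_integral_scale_measure)
  then show ?thesis
    by (subst (asm) nn_integral_distr) (simp_all add: nn_integral_density)
qed

text \<open>The sure event is a past event; for it, independence of the recentred future becomes
  stationarity of the increments.\<close>

lemma distr_recentre: "distr P (path_space G) (recentre m) = P"
proof (rule measure_eqI)
  fix E assume "E \<in> sets (distr P (path_space G) (recentre m))"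
  then have [measurable]: "E \<in> sets (path_space G)" by simp
  have "space P \<inter> (recentre m -` E \<inter> space P) = recentre m -` E \<inter> space P" by blast
  then show "emeasure (distr P (path_space G) (recentre m)) E = emeasure P E"
    using past_space[of m] emeasure_space_1 by (simp add: emeasure_distr past_def)
qed simp

lemma AE_recentre:
  assumes [measurable]: "Measurable.pred (path_space G) Q" and "AE \<omega> in P. Q \<omega>"
  shows "AE \<omega> in P. Q (recentre m \<omega>)"
proof -
  have "AE \<omega> in distr P (path_space G) (recentre m). Q \<omega>"
    unfolding distr_recentre by fact
  then show ?thesis
    by (subst (asm) AE_distr_iff) auto
qed

lemma AE_recentre_0: "AE \<omega> in P. recentre 0 \<omega> = \<omega>"
  using AE_start AE_space
proof eventually_elim
  case (elim \<omega>)
  then show ?case by (auto simp: recentre_def space_path_space)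
qed

text \<open>An invariant event agrees almost surely with its preimage under
  \<open>recentre n\<close>, hence is independent of every cylinder that ends at time
  \<open>n\<close>. Independence extends to all events, in particular to the event itself, so its
  probability p satisfies p = p * p.\<close>

lemma ergodic:
  assumes [measurable]: "E \<in> sets (path_space G)"
    and inv: "\<And>\<omega>. \<omega> \<in> space P \<Longrightarrow> recentre 1 \<omega> \<in> E \<longleftrightarrow> \<omega> \<in> E"
  shows "prob E = 0 \<or> prob E = 1"
proof -
  have AE_inv: "AE \<omega> in P. recentre m \<omega> \<in> E \<longleftrightarrow> \<omega> \<in> E" for m
  proof -
    \<comment> \<open>The chain of invariances descends to \<open>recentre 0 \<omega>\<close>;
      replacing that path by \<omega> costs a null set.\<close>
    have "recentre m \<omega> \<in> E \<longleftrightarrow> recentre 0 \<omega> \<in> E" if "\<omega> \<in> space P" for \<omega>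
    proof (induction m)
      case (Suc m)
      have "recentre (Suc m) \<omega> = recentre 1 (recentre m \<omega>)"
        using that by (simp add: recentre_recentre)
      then show ?case
        using Suc inv[of "recentre m \<omega>"] recentre_in_space that by simp
    qed simp
    note step = this
    show ?thesis
      using AE_recentre_0 AE_space by eventually_elim (simp add: step)
  qed
  have "density P (indicator E) = scale_measure (emeasure P E) P"
  proof (rule measure_eqI_cylinder[OF countable_carrier])
    show "finite_measure (density P (indicator E))"
      by (rule finite_measure_restricted) simp
    fix n and x :: "nat \<Rightarrow> 'a" assume x: "\<forall>i\<le>n. x i \<in> carrier G"
    have "emeasure P (cylinder G n x \<inter> (recentre n -` E \<inter> space P)) = emeasure P (E \<inter> cylinder G n x)"
      using AE_inv[of n] by (intro emeasure_eq_AE) (auto elim!: AE_mp)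
    then show "emeasure (density P (indicator E)) (cylinder G n x) =
        emeasure (scale_measure (emeasure P E) P) (cylinder G n x)"
      using past_cylinder[OF x] by (simp add: emeasure_restricted past_def emeasure_scale_measure mult.commute)
  qed simp_all
  then have "emeasure (density P (indicator E)) E = emeasure (scale_measure (emeasure P E) P) E"
    by simp
  then have "prob E = prob E * prob E"
    by (simp add: emeasure_restricted emeasure_scale_measure emeasure_eq_measure ennreal_mult[symmetric])
  then show ?thesis by simp
qed

end

section \<open>The maximal ergodic theorem\<close>

context random_walk
begin

text \<open>The maximum of 0 and the Birkhoff sums of at most \<open>n\<close> terms, in recursive
  form: this is the form in which it can be compared with its own composition with
  \<open>recentre 1\<close>.\<close>

primrec max_birkhoff :: "((nat \<Rightarrow> 'a) \<Rightarrow> real) \<Rightarrow> nat \<Rightarrow> (nat \<Rightarrow> 'a) \<Rightarrow> real" where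
  "max_birkhoff h 0 = (\<lambda>\<omega>. 0)"
| "max_birkhoff h (Suc n) = (\<lambda>\<omega>. max 0 (h (recentre 0 \<omega>) + max_birkhoff h n (recentre 1 \<omega>)))"

lemma max_birkhoff_nonneg: "0 \<le> max_birkhoff h n \<omega>"
  by (cases n) auto

lemma max_birkhoff_mono: "m \<le> n \<Longrightarrow> max_birkhoff h m \<omega> \<le> max_birkhoff h n \<omega>"
proof (induction m arbitrary: n \<omega>)
  case (Suc m)
  then obtain n' where n': "n = Suc n'" "m \<le> n'" by (cases n) auto
  then show ?case
    using Suc.IH[OF n'(2), of "recentre 1 \<omega>"] by (simp add: max.coboundedI2)
qed (simp add: max_birkhoff_nonneg)

lemma sum_recentre_Suc:
  assumes "\<omega> \<in> space (path_space G)"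
  shows "(\<Sum>k<Suc m. h (recentre k \<omega>)) = h (recentre 0 \<omega>) + (\<Sum>k<m. h (recentre k (recentre 1 \<omega>)))"
  using assms by (simp only: sum.lessThan_Suc_shift recentre_recentre plus_1_eq_Suc)

lemma sum_le_max_birkhoff:
  fixes h :: "(nat \<Rightarrow> 'a) \<Rightarrow> real"
  shows "\<omega> \<in> space (path_space G) \<Longrightarrow> (\<Sum>k<m. h (recentre k \<omega>)) \<le> max_birkhoff h m \<omega>"
proof (induction m arbitrary: \<omega>)
  case (Suc m)
  then show ?case
    unfolding sum_recentre_Suc[OF Suc.prems]
    using Suc.IH[of "recentre 1 \<omega>"] recentre_in_space[of \<omega> 1] Suc.prems
    by (simp add: max.coboundedI2)
qed simp

lemma measurable_max_birkhoff [measurable]: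
  assumes [measurable]: "h \<in> borel_measurable (path_space G)"
  shows "max_birkhoff h n \<in> borel_measurable (path_space G)"
  by (induction n) simp_all

lemma integrable_recentre:
  fixes h :: "(nat \<Rightarrow> 'a) \<Rightarrow> real"
  assumes "integrable P h"
  shows "integrable P (\<lambda>\<omega>. h (recentre m \<omega>))"
    and "(\<integral>\<omega>. h (recentre m \<omega>) \<partial>P) = (\<integral>\<omega>. h \<omega> \<partial>P)"
proof -
  have [measurable]: "h \<in> borel_measurable (path_space G)"
    using borel_measurable_integrable[OF assms] by simp
  show "integrable P (\<lambda>\<omega>. h (recentre m \<omega>))"
    by (rule integrable_distr[of _ _ "path_space G"]) (simp_all add: distr_recentre assms)
  show "(\<integral>\<omega>. h (recentre m \<omega>) \<partial>P) = (\<integral>\<omega>. h \<omega> \<partial>P)"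
    by (subst integral_distr[of _ _ "path_space G", symmetric]) (simp_all add: distr_recentre)
qed

lemma integrable_max_birkhoff:
  fixes h :: "(nat \<Rightarrow> 'a) \<Rightarrow> real"
  assumes h: "integrable P h"
  shows "integrable P (max_birkhoff h n)"
proof (induction n)
  case (Suc n)
  then show ?case
    using integrable_recentre(1)[OF h, of 0] integrable_recentre(1)[OF Suc, of 1]
    by (simp add: integrable_max)
qed simp

text \<open>Garsia's argument: where the maximum \<open>M\<close> of the Birkhoff sums is positive, the first term
  dominates \<open>M - M \<circ> recentre 1\<close>, whose integral vanishes by stationarity.\<close>

lemma maximal_ergodic:
  fixes h :: "(nat \<Rightarrow> 'a) \<Rightarrow> real"
  assumes h: "integrable P h"
    and pos: "AE \<omega> in P. \<exists>m. 0 < (\<Sum>k<m. h (recentre k \<omega>))"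
  shows "0 \<le> (\<integral>\<omega>. h \<omega> \<partial>P)"
proof -
  have [measurable]: "h \<in> borel_measurable (path_space G)"
    using borel_measurable_integrable[OF h] by simp
  define M where "M n = max_birkhoff h (Suc n)" for n
  have [measurable]: "M n \<in> borel_measurable (path_space G)" for n
    unfolding M_def by (rule measurable_max_birkhoff) simp
  define Z where "Z n = (\<lambda>\<omega>. if 0 < M n \<omega> then h (recentre 0 \<omega>) else 0)" for n
  have h0: "integrable P (\<lambda>\<omega>. h (recentre 0 \<omega>))"
    by (rule integrable_recentre(1)[OF h])
  have M: "integrable P (M n)" for n
    unfolding M_def by (rule integrable_max_birkhoff[OF h])
  have Z: "integrable P (Z n)" for n
    by (rule Bochner_Integration.integrable_bound[OF h0]) (auto simp: Z_def)
  have ge: "0 \<le> (\<integral>\<omega>. Z n \<omega> \<partial>P)" for n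
  proof -
    have "M n \<omega> - M n (recentre 1 \<omega>) \<le> Z n \<omega>" for \<omega>
      using max_birkhoff_nonneg[of h "Suc n" "recentre 1 \<omega>"]
        max_birkhoff_mono[of n "Suc n" h "recentre 1 \<omega>"]
      by (auto simp: M_def Z_def max_def split: if_splits)
    then have "(\<integral>\<omega>. M n \<omega> - M n (recentre 1 \<omega>) \<partial>P) \<le> (\<integral>\<omega>. Z n \<omega> \<partial>P)"
      using M[of n] Z integrable_recentre(1)[OF M[of n]] by (intro integral_mono) auto
    then show ?thesis
      using M[of n] integrable_recentre[OF M[of n], of 1] by simp
  qed
  \<comment> \<open>By \<open>pos\<close> almost every path has some positive Birkhoff sum, so the
    truncation in \<open>Z n\<close> eventually disappears, and dominated convergence transfers the
    sign to the full integral.\<close>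
  have "(\<lambda>n. \<integral>\<omega>. Z n \<omega> \<partial>P) \<longlonglongrightarrow> (\<integral>\<omega>. h (recentre 0 \<omega>) \<partial>P)"
  proof (rule integral_dominated_convergence[where w = "\<lambda>\<omega>. \<bar>h (recentre 0 \<omega>)\<bar>"])
    show "AE \<omega> in P. (\<lambda>n. Z n \<omega>) \<longlonglongrightarrow> h (recentre 0 \<omega>)"
      using pos AE_space
    proof eventually_elim
      case (elim \<omega>)
      then obtain m where m: "0 < (\<Sum>k<m. h (recentre k \<omega>))" by blast
      have "Z n \<omega> = h (recentre 0 \<omega>)" if "m \<le> n" for n
        using m sum_le_max_birkhoff[of \<omega> h m] max_birkhoff_mono[of m "Suc n" h \<omega>] elim(2) that
        by (simp add: Z_def M_def del: max_birkhoff.simps)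
      then show ?case
        by (intro tendsto_eventually) (auto simp: eventually_at_top_linorder)
    qed
  qed (use h0 in \<open>auto simp: Z_def\<close>)
  then have "0 \<le> (\<integral>\<omega>. h (recentre 0 \<omega>) \<partial>P)"
    by (rule LIMSEQ_le_const) (use ge in auto)
  then show ?thesis
    by (simp add: integrable_recentre(2)[OF h])
qed

text \<open>A one-sided form of the pointwise ergodic theorem. The function \<open>c - w\<close> has
  negative mean. The event that its Birkhoff sums are unbounded above is invariant, so it has
  probability 0 or 1; probability 1 would contradict the maximal ergodic theorem.\<close>

lemma ergodic_lower_bound:
  fixes w :: "(nat \<Rightarrow> 'a) \<Rightarrow> real"
  assumes w: "integrable P w" and c: "c < (\<integral>\<omega>. w \<omega> \<partial>P)"
  shows "AE \<omega> in P. \<exists>K. \<forall>m. c * real m - K \<le> (\<Sum>k<m. w (recentre k \<omega>))"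
proof -
  have [measurable]: "w \<in> borel_measurable (path_space G)"
    using borel_measurable_integrable[OF w] by simp
  define h where "h \<omega> = c - w \<omega>" for \<omega>
  have [measurable]: "h \<in> borel_measurable (path_space G)"
    unfolding h_def by measurable
  have h: "integrable P h"
    unfolding h_def using w by simp
  define S where "S m \<omega> = (\<Sum>k<m. h (recentre k \<omega>))" for m \<omega>
  have [measurable]: "S m \<in> borel_measurable (path_space G)" for m
    unfolding S_def by measurable
  define E where "E = {\<omega> \<in> space P. \<forall>N::nat. \<exists>m. real N < S m \<omega>}"
  have E: "E \<in> sets (path_space G)"
    unfolding E_def space_P by measurable
  have "prob E = 0 \<or> prob E = 1"
  proof (rule ergodic[OF E])
    fix \<omega> assume \<omega>: "\<omega> \<in> space P"
    have shift: "S (Suc m) \<omega> = h (recentre 0 \<omega>) + S m (recentre 1 \<omega>)" for m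
      unfolding S_def using \<omega> by (intro sum_recentre_Suc) simp
    show "recentre 1 \<omega> \<in> E \<longleftrightarrow> \<omega> \<in> E"
    proof
      assume *: "recentre 1 \<omega> \<in> E"
      have "\<exists>m. real N < S m \<omega>" for N
      proof -
        obtain N' :: nat where "real N - h (recentre 0 \<omega>) \<le> real N'"
          using real_arch_simple by blast
        moreover obtain m where "real N' < S m (recentre 1 \<omega>)"
          using * by (auto simp: E_def)
        ultimately show ?thesis
          using shift[of m] by (intro exI[of _ "Suc m"]) simp
      qed
      then show "\<omega> \<in> E" using \<omega> by (simp add: E_def)
    next
      assume *: "\<omega> \<in> E"
      have "\<exists>m. real N < S m (recentre 1 \<omega>)" for N
      proof -
        \<comment> \<open>The lower bound 0 rules out the empty sum, so that a first term can be
          split off.\<close>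
        obtain N' :: nat where N': "max 0 (real N + h (recentre 0 \<omega>)) \<le> real N'"
          using real_arch_simple by blast
        obtain m where m: "real N' < S m \<omega>"
          using * by (auto simp: E_def)
        then have "m \<noteq> 0" using N' by (auto simp: S_def intro: ccontr)
        then obtain m' where "m = Suc m'" by (cases m) auto
        then show ?thesis
          using shift[of m'] N' m by (intro exI[of _ m']) simp
      qed
      then show "recentre 1 \<omega> \<in> E"
        using \<omega> recentre_in_space by (simp add: E_def)
    qed
  qed
  moreover have "prob E \<noteq> 1"
  proof
    assume "prob E = 1"
    then have "AE \<omega> in P. \<omega> \<in> E"
      using E by (simp add: prob_eq_1)
    then have "AE \<omega> in P. \<exists>m. 0 < (\<Sum>k<m. h (recentre k \<omega>))"
    proof eventually_elim
      case (elim \<omega>)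
      then have "\<exists>m. real 0 < S m \<omega>" unfolding E_def by blast
      then show ?case by (simp add: S_def)
    qed
    then have "0 \<le> (\<integral>\<omega>. h \<omega> \<partial>P)"
      by (rule maximal_ergodic[OF h])
    then show False
      using c w by (simp add: h_def prob_space)
  qed
  ultimately have "AE \<omega> in P. \<omega> \<notin> E"
    using E by (simp add: prob_eq_0)
  then show ?thesis
    using AE_space
  proof eventually_elim
    case (elim \<omega>)
    then obtain N :: nat where N: "\<And>m. S m \<omega> \<le> real N"
      by (auto simp: E_def not_less)
    have "c * real m - real N \<le> (\<Sum>k<m. w (recentre k \<omega>))" for m
      using N[of m] by (simp add: S_def h_def sum_subtractf mult.commute)
    then show ?case by blast
  qed
qed

end

section \<open>Densities on invariant subfields\<close>

lemma path_shift_funpow: "(path_shift ^^ m) \<omega> = (\<lambda>n. \<omega> (m + n))"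
  by (induction m) (auto simp: path_shift_def)

text \<open>Left translation commutes with the shift. This allows the full invariant field to be
  treated by the same theory as \<open>J\<close> and compared with it.\<close>

lemma group_closed_invariant_sets:
  assumes "group G"
  shows "group_closed G (invariant_sets G)"
proof (unfold group_closed_def, intro ballI)
  interpret group G by fact
  let ?S = "space (path_space G)"
  fix \<gamma> A assume \<gamma>: "\<gamma> \<in> carrier G" and A: "A \<in> invariant_sets G"
  let ?T = "path_translate G (inv\<^bsub>G\<^esub> \<gamma>)"
  have T: "?T \<in> measurable (path_space G) (path_space G)"
    unfolding path_translate_def using \<gamma>
    by (intro measurable_path_spaceI measurable_compose[OF measurable_path_coord]) auto
  have inv: "path_shift \<omega> \<in> A \<longleftrightarrow> \<omega> \<in> A" if "\<omega> \<in> ?S" for \<omega>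
    using A that by (auto simp: invariant_sets_def)
  have A_sub: "A \<subseteq> ?S"
    using A sets.sets_into_space by (auto simp: invariant_sets_def)
  \<comment> \<open>The image is a preimage under the inverse translation, which gives its
    measurability.\<close>
  have img: "path_translate G \<gamma> ` A = ?T -` A \<inter> ?S"
  proof (intro equalityI subsetI)
    fix \<omega> assume "\<omega> \<in> path_translate G \<gamma> ` A"
    then obtain \<eta> where \<eta>: "\<eta> \<in> A" "\<omega> = path_translate G \<gamma> \<eta>" by blast
    then have c: "\<eta> n \<in> carrier G" for n using A_sub by (auto simp: space_path_space)
    have "?T \<omega> = \<eta>"
      using c \<gamma> by (simp add: \<eta> path_translate_def m_assoc[symmetric])
    then show "\<omega> \<in> ?T -` A \<inter> ?S"
      using \<eta> c \<gamma> by (auto simp: space_path_space path_translate_def)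
  next
    fix \<omega> assume \<omega>: "\<omega> \<in> ?T -` A \<inter> ?S"
    then have "path_translate G \<gamma> (?T \<omega>) = \<omega>"
      using \<gamma> by (simp add: space_path_space path_translate_def m_assoc[symmetric])
    then show "\<omega> \<in> path_translate G \<gamma> ` A"
      using \<omega> by (metis IntD1 image_eqI vimageE)
  qed
  have "path_shift \<omega> \<in> ?T -` A \<inter> ?S \<longleftrightarrow> \<omega> \<in> ?T -` A \<inter> ?S" if "\<omega> \<in> ?S" for \<omega>
  proof -
    have "?T (path_shift \<omega>) = path_shift (?T \<omega>)"
      by (simp add: path_translate_def path_shift_def)
    moreover have "?T \<omega> \<in> ?S" "path_shift \<omega> \<in> ?S"
      using that \<gamma> by (auto simp: path_translate_def path_shift_def space_path_space)
    ultimately show ?thesis using inv[of "?T \<omega>"] that by simp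
  qed
  then have "path_shift -` (?T -` A \<inter> ?S) \<inter> ?S = ?T -` A \<inter> ?S" by blast
  moreover have "?T -` A \<inter> ?S \<in> sets (path_space G)"
    using A by (intro measurable_sets[OF T]) (simp add: invariant_sets_def)
  ultimately show "path_translate G \<gamma> ` A \<in> invariant_sets G"
    unfolding img by (simp add: invariant_sets_def)
qed

lemma sigma_algebra_invariant_sets:
  "sigma_algebra (space (path_space G)) (invariant_sets G)"
proof (unfold sigma_algebra_iff2, intro conjI ballI allI impI)
  let ?S = "space (path_space G)"
  have shift: "path_shift \<omega> \<in> ?S" if "\<omega> \<in> ?S" for \<omega>
    using that by (auto simp: space_path_space path_shift_def)
  show "invariant_sets G \<subseteq> Pow ?S"
    using sets.sets_into_space by (fastforce simp: invariant_sets_def)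
  show "{} \<in> invariant_sets G" by (simp add: invariant_sets_def)
  show "?S - A \<in> invariant_sets G" if "A \<in> invariant_sets G" for A
  proof -
    have "path_shift -` (?S - A) \<inter> ?S = ?S - (path_shift -` A \<inter> ?S)"
      using shift by blast
    then show ?thesis using that by (auto simp: invariant_sets_def)
  qed
  show "(\<Union>i. A i) \<in> invariant_sets G" if "range A \<subseteq> invariant_sets G" for A :: "nat \<Rightarrow> _"
  proof -
    have "path_shift -` (\<Union>i. A i) \<inter> ?S = (\<Union>i. path_shift -` A i \<inter> ?S)" by blast
    also have "\<dots> = (\<Union>i. A i)"
      using that by (intro SUP_cong) (auto simp: invariant_sets_def)
    finally have "path_shift -` (\<Union>i. A i) \<inter> ?S = (\<Union>i. A i)" .
    moreover have "(\<Union>i. A i) \<in> sets (path_space G)"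
      using that by (intro sets.countable_UN) (auto simp: invariant_sets_def)
    ultimately show ?thesis by (simp add: invariant_sets_def)
  qed
qed

context random_walk
begin

lemma measurable_P_eq: "measurable P N = measurable (path_space G) N"
  by (rule measurable_cong_sets) simp_all

section \<open>Positions charged by the walk, and left translations of paths\<close>

definition position_prob :: "nat \<Rightarrow> 'a \<Rightarrow> real" where
  "position_prob m x = prob {\<omega> \<in> space P. \<omega> m = x}"

text \<open>These points form a semigroup, in general not the whole group. Absolute continuity of
  the translated law on invariant sets is obtained only for them, because it comes from conditioning
  on a visit.\<close>

definition reachable :: "'a set" where
  "reachable = {x \<in> carrier G. \<exists>m. position_prob m x > 0}"

lemma position_prob_nonneg: "0 \<le> position_prob m x"
  by (simp add: position_prob_def)

lemma reachable_carrier: "x \<in> reachable \<Longrightarrow> x \<in> carrier G"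
  by (simp add: reachable_def)

lemma one_reachable: "\<one> \<in> reachable"
proof -
  have "prob {\<omega> \<in> space P. \<omega> 0 = \<one>} = 1"
    using AE_start by (subst prob_Collect_eq_1) auto
  then show ?thesis
    by (auto simp: reachable_def position_prob_def intro!: exI[of _ 0])
qed

lemma mult_reachable:
  assumes x: "x \<in> reachable" and y: "y \<in> reachable"
  shows "x \<otimes> y \<in> reachable"
proof -
  obtain m n where m: "position_prob m x > 0" and n: "position_prob n y > 0"
    using x y by (auto simp: reachable_def)
  let ?B = "{\<omega> \<in> space P. \<omega> m = x}" and ?E = "{\<omega> \<in> space P. \<omega> n = y}"
  have E: "?E \<in> sets (path_space G)" by simp
  have "emeasure P (?B \<inter> (recentre m -` ?E \<inter> space P)) = emeasure P ?B * emeasure P ?E"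
    using past_position[of m x] E unfolding past_def by blast
  then have "0 < prob (?B \<inter> (recentre m -` ?E \<inter> space P))"
    using m n by (simp add: emeasure_eq_measure ennreal_mult[symmetric] position_prob_def)
  also have "\<dots> \<le> position_prob (m + n) (x \<otimes> y)"
    unfolding position_prob_def
  proof (rule finite_measure_mono)
    show "?B \<inter> (recentre m -` ?E \<inter> space P) \<subseteq> {\<omega> \<in> space P. \<omega> (m + n) = x \<otimes> y}"
      using x by (auto simp: recentre_def space_path_space reachable_def m_assoc[symmetric])
  qed simp
  finally show ?thesis
    using x y by (auto simp: reachable_def)
qed

text \<open>Allows a statement with an exceptional null set depending on \<open>x\<close> to be
  evaluated at the random position: there are countably many points, and the uncharged ones may be
  ignored.\<close>

lemma AE_at_position:
  assumes "\<And>x. x \<in> carrier G \<Longrightarrow> position_prob m x > 0 \<Longrightarrow> AE \<omega> in P. \<omega> m = x \<longrightarrow> Q x \<omega>"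
  shows "AE \<omega> in P. Q (\<omega> m) \<omega>"
proof -
  have "AE \<omega> in P. \<omega> m = x \<longrightarrow> Q x \<omega>" if x: "x \<in> carrier G" for x
  proof (cases "position_prob m x > 0")
    case False
    then have "position_prob m x = 0"
      using position_prob_nonneg[of m x] by linarith
    then have "prob {\<omega> \<in> space P. \<omega> m = x} = 0"
      by (simp add: position_prob_def)
    then have "AE \<omega> in P. \<omega> m \<noteq> x"
      by (subst (asm) prob_Collect_eq_0) auto
    then show ?thesis by eventually_elim simp
  qed (use assms x in blast)
  then have "AE \<omega> in P. \<forall>x\<in>carrier G. \<omega> m = x \<longrightarrow> Q x \<omega>"
    by (subst AE_ball_countable[OF countable_carrier]) blast
  then show ?thesis
    using AE_space by eventually_elim (auto simp: space_path_space)
qed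

abbreviation translate :: "'a \<Rightarrow> (nat \<Rightarrow> 'a) \<Rightarrow> nat \<Rightarrow> 'a" where
  "translate \<equiv> path_translate G"

lemma measurable_translate:
  "x \<in> carrier G \<Longrightarrow> translate x \<in> measurable (path_space G) (path_space G)"
  unfolding path_translate_def
  by (intro measurable_path_spaceI measurable_compose[OF measurable_path_coord]) auto

lemma translate_in_space:
  "x \<in> carrier G \<Longrightarrow> \<omega> \<in> space (path_space G) \<Longrightarrow> translate x \<omega> \<in> space (path_space G)"
  by (simp add: path_translate_def space_path_space)

lemma translate_translate:
  "x \<in> carrier G \<Longrightarrow> y \<in> carrier G \<Longrightarrow> \<omega> \<in> space (path_space G) \<Longrightarrow>
    translate x (translate y \<omega>) = translate (x \<otimes> y) \<omega>"
  by (simp add: path_translate_def space_path_space m_assoc)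

lemma translate_one: "\<omega> \<in> space (path_space G) \<Longrightarrow> translate \<one> \<omega> = \<omega>"
  by (simp add: path_translate_def space_path_space)

text \<open>For shift-invariant functions, recentring is thus the same as translating by the inverse
  of the position.\<close>

lemma recentre_eq_shift_translate:
  "recentre m \<omega> = (path_shift ^^ m) (translate (inv (\<omega> m)) \<omega>)"
  by (simp add: recentre_def path_shift_funpow path_translate_def)

end

text \<open>Kept general in \<open>J\<close> so that it can be instantiated a second time, with the
  full invariant field.\<close>

locale walk_field = random_walk G \<mu> P for G :: "('a, 'b) monoid_scheme" (structure) and \<mu> P +
  fixes J :: "(nat \<Rightarrow> 'a) set set"
  assumes sigma_algebra_J: "sigma_algebra (space (path_space G)) J"
    and J_invariant: "J \<subseteq> invariant_sets G"
    and J_closed: "group_closed G J"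
begin

definition F :: "(nat \<Rightarrow> 'a) measure" where
  "F = sigma (space (path_space G)) J"

lemma space_F [simp]: "space F = space (path_space G)"
  and sets_F [simp]: "sets F = J"
  using sigma_algebra.sigma_sets_eq[OF sigma_algebra_J] sigma_algebra_J
  by (simp_all add: F_def sigma_algebra_iff2 space_measure_of_conv)

lemma subalgebra_F: "subalgebra P F"
  using J_invariant by (auto simp: subalgebra_def invariant_sets_def)

lemma measurable_F_P: "f \<in> measurable F N \<Longrightarrow> f \<in> measurable (path_space G) N"
  using measurable_from_subalg[OF subalgebra_F] measurable_P_eq by blast

text \<open>Points are closed in a T1 space, so the level sets of \<open>f\<close> lie in
  \<open>J\<close> and are shift-invariant. The equality therefore holds at every path, not merely
  almost surely.\<close>

lemma borel_F_shift:
  fixes f :: "(nat \<Rightarrow> 'a) \<Rightarrow> 'c :: t1_space"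
  assumes f: "f \<in> borel_measurable F" and \<omega>: "\<omega> \<in> space (path_space G)"
  shows "f ((path_shift ^^ m) \<omega>) = f \<omega>"
proof (induction m)
  case (Suc m)
  let ?\<eta> = "(path_shift ^^ m) \<omega>"
  have "f -` {f ?\<eta>} \<inter> space F \<in> sets F"
    by (rule measurable_sets[OF f]) simp
  then have "f -` {f ?\<eta>} \<inter> space F \<in> invariant_sets G"
    using J_invariant by auto
  then have "path_shift -` (f -` {f ?\<eta>} \<inter> space F) \<inter> space F = f -` {f ?\<eta>} \<inter> space F"
    by (simp add: invariant_sets_def)
  moreover have "?\<eta> \<in> space F"
    using \<omega> by (simp add: path_shift_funpow space_path_space)
  ultimately have "f (path_shift ?\<eta>) = f ?\<eta>" by blast
  then show ?case using Suc by simp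
qed simp

lemma borel_F_recentre:
  fixes f :: "(nat \<Rightarrow> 'a) \<Rightarrow> 'c :: t1_space"
  assumes f: "f \<in> borel_measurable F" and \<omega>: "\<omega> \<in> space (path_space G)"
  shows "f (recentre m \<omega>) = f (translate (inv (\<omega> m)) \<omega>)"
proof -
  have "\<omega> m \<in> carrier G" using \<omega> by (simp add: space_path_space)
  then show ?thesis
    using \<omega> unfolding recentre_eq_shift_translate
    by (intro borel_F_shift[OF f] translate_in_space) auto
qed

lemma measurable_translate_F:
  assumes x: "x \<in> carrier G"
  shows "translate x \<in> measurable F F"
proof (rule measurableI)
  fix A assume AF: "A \<in> sets F"
  have A: "A \<in> J" "A \<subseteq> space (path_space G)"
    using AF sets.sets_into_space[OF AF] by simp_all
  have "translate x -` A \<inter> space F = translate (inv x) ` A"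
  proof (intro equalityI subsetI)
    fix \<omega> assume "\<omega> \<in> translate x -` A \<inter> space F"
    then have "translate (inv x) (translate x \<omega>) = \<omega>" "translate x \<omega> \<in> A"
      using x by (auto simp: translate_translate translate_one)
    then show "\<omega> \<in> translate (inv x) ` A" by (metis imageI)
  next
    fix \<omega> assume "\<omega> \<in> translate (inv x) ` A"
    then obtain \<eta> where "\<eta> \<in> A" "\<omega> = translate (inv x) \<eta>" by blast
    then show "\<omega> \<in> translate x -` A \<inter> space F"
      using x A(2) by (auto simp: translate_translate translate_one subset_eq intro!: translate_in_space)
  qed
  then show "translate x -` A \<inter> space F \<in> sets F"
    using J_closed A x by (simp add: group_closed_def)
qed (use x in \<open>simp add: translate_in_space\<close>)

text \<open>The Markov property for invariant functions: on \<open>B\<close> the path and the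
  recentred path translated by \<open>x\<close> give the same value of \<open>H\<close>, and the
  recentred path is independent of \<open>B\<close>.\<close>

lemma nn_integral_past_position:
  fixes H :: "(nat \<Rightarrow> 'a) \<Rightarrow> ennreal"
  assumes B: "past m B" "\<And>\<omega>. \<omega> \<in> B \<Longrightarrow> \<omega> m = x" and x: "x \<in> carrier G"
    and H: "H \<in> borel_measurable F"
  shows "(\<integral>\<^sup>+\<omega>. indicator B \<omega> * H \<omega> \<partial>P) = emeasure P B * (\<integral>\<^sup>+\<omega>. H (translate x \<omega>) \<partial>P)"
proof -
  have HT: "(\<lambda>\<omega>. H (translate x \<omega>)) \<in> borel_measurable F"
    by (rule measurable_compose[OF measurable_translate_F[OF x] H])
  have "(\<integral>\<^sup>+\<omega>. indicator B \<omega> * H \<omega> \<partial>P) =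
      (\<integral>\<^sup>+\<omega>. indicator B \<omega> * H (translate x (recentre m \<omega>)) \<partial>P)"
  proof (intro nn_integral_cong)
    fix \<omega> assume "\<omega> \<in> space P"
    then have \<omega>: "\<omega> \<in> space (path_space G)" by simp
    show "indicator B \<omega> * H \<omega> = indicator B \<omega> * H (translate x (recentre m \<omega>))"
    proof (cases "\<omega> \<in> B")
      case True
      then have "H (translate x (recentre m \<omega>)) = H (translate x (translate (inv x) \<omega>))"
        using borel_F_recentre[OF HT \<omega>, of m] B by simp
      also have "\<dots> = H \<omega>"
        using x \<omega> by (simp add: translate_translate translate_one)
      finally show ?thesis by simp
    qed simp
  qed
  also have "\<dots> = emeasure P B * (\<integral>\<^sup>+\<omega>. H (translate x \<omega>) \<partial>P)"
    by (rule nn_integral_past[OF B(1) measurable_F_P[OF HT]])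
  finally show ?thesis .
qed

text \<open>Let \<open>x\<close> be charged at time \<open>m\<close>. On \<open>J\<close>, the
  restriction of \<open>P\<close> to the visit of \<open>x\<close> at time \<open>m\<close> is a
  positive multiple of the translated law. Hence \<open>P\<close>-null sets of \<open>J\<close> are
  null for that law, and the Radon-Nikodym theorem applies.\<close>

lemma dens_exists:
  assumes x: "x \<in> reachable"
  shows "\<exists>f :: (nat \<Rightarrow> 'a) \<Rightarrow> real. f \<in> borel_measurable F \<and> (\<forall>\<omega>. 0 \<le> f \<omega>) \<and>
    density (restr_to_subalg P F) (\<lambda>\<omega>. ennreal (f \<omega>)) =
      restr_to_subalg (distr P (path_space G) (translate x)) F"
proof -
  let ?M = "restr_to_subalg P F"
  let ?D = "distr P (path_space G) (translate x)"
  let ?N = "restr_to_subalg ?D F"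
  obtain m where m: "position_prob m x > 0" and xc: "x \<in> carrier G"
    using x by (auto simp: reachable_def)
  have T: "translate x \<in> measurable P (path_space G)"
    using measurable_translate[OF xc] by (simp add: measurable_P_eq)
  have D: "prob_space ?D"
    by (rule prob_space_distr[OF T])
  have sub: "subalgebra ?D F"
    using subalgebra_F by (simp add: subalgebra_def)
  interpret M: prob_space ?M
    by (rule prob_space_restr_to_subalg[OF subalgebra_F prob_space_axioms])
  have ac: "absolutely_continuous ?M ?N"
    unfolding absolutely_continuous_def
  proof
    fix A assume A: "A \<in> null_sets ?M"
    then have AJ: "A \<in> sets F" and A0: "A \<in> null_sets P"
      by (simp_all add: null_sets_restr_to_subalg[OF subalgebra_F])
    have [measurable]: "A \<in> sets P" using A0 by auto
    have "(\<integral>\<^sup>+\<omega>. indicator {\<omega> \<in> space P. \<omega> m = x} \<omega> * indicator A \<omega> \<partial>P) =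
        emeasure P {\<omega> \<in> space P. \<omega> m = x} * (\<integral>\<^sup>+\<omega>. indicator A (translate x \<omega>) \<partial>P)"
      by (rule nn_integral_past_position[OF past_position]) (use xc in \<open>auto intro: borel_measurable_indicator AJ\<close>)
    moreover have "(\<integral>\<^sup>+\<omega>. indicator {\<omega> \<in> space P. \<omega> m = x} \<omega> * indicator A \<omega> \<partial>P) = 0"
      using AE_not_in[OF A0] by (subst nn_integral_0_iff_AE) (auto elim!: AE_mp)
    moreover have "(\<integral>\<^sup>+\<omega>. indicator A (translate x \<omega>) \<partial>P) = emeasure ?D A"
    proof -
      have "(\<integral>\<^sup>+\<omega>. indicator A (translate x \<omega>) \<partial>P) = (\<integral>\<^sup>+\<omega>. indicator A \<omega> \<partial>?D)"
        by (rule nn_integral_distr[OF T, symmetric]) simp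
      also have "\<dots> = emeasure ?D A"
        by (rule nn_integral_indicator) (use A0 in \<open>simp add: null_sets_def\<close>)
      finally show ?thesis .
    qed
    ultimately have "emeasure ?D A = 0"
      using m by (simp add: position_prob_def emeasure_eq_measure)
    then show "A \<in> null_sets ?N"
      unfolding null_sets_restr_to_subalg[OF sub] using AJ A0 by (simp add: null_sets_def)
  qed
  have sets_N: "sets ?N = sets ?M"
    by (simp add: sets_restr_to_subalg[OF sub] sets_restr_to_subalg[OF subalgebra_F])
  have fin_N: "finite_measure ?N"
    using D by (intro finite_measure_restr_to_subalg[OF sub] prob_space.finite_measure)
  obtain f where f: "f \<in> borel_measurable ?M" "AE \<omega> in ?M. RN_deriv ?M ?N \<omega> = ennreal (f \<omega>)"
      "AE \<omega> in ?N. 0 < f \<omega>" "\<And>\<omega>. 0 \<le> f \<omega>"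
    by (rule M.real_RN_deriv[OF fin_N ac sets_N]) (rule that)
  have "density ?M (\<lambda>\<omega>. ennreal (f \<omega>)) = density ?M (RN_deriv ?M ?N)"
    using f by (intro density_cong) auto
  also have "\<dots> = ?N"
    by (rule M.density_RN_deriv[OF ac sets_N])
  finally show ?thesis
    using f measurable_in_subalg'[OF subalgebra_F f(1)] by blast
qed

text \<open>The default 0 off \<open>reachable\<close> makes measurability and nonnegativity
  unconditional; such points carry weight \<open>position_prob m x = 0\<close> at every
  time.\<close>

definition dens :: "'a \<Rightarrow> (nat \<Rightarrow> 'a) \<Rightarrow> real" where
  "dens x = (if x \<in> reachable then
     (SOME f. f \<in> borel_measurable F \<and> (\<forall>\<omega>. 0 \<le> f \<omega>) \<and>
        density (restr_to_subalg P F) (\<lambda>\<omega>. ennreal (f \<omega>)) =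
          restr_to_subalg (distr P (path_space G) (translate x)) F)
     else (\<lambda>_. 0))"

lemma measurable_dens [measurable]: "dens x \<in> borel_measurable F"
  and dens_nonneg: "0 \<le> dens x \<omega>"
  using someI_ex[OF dens_exists, of x] by (auto simp: dens_def)

lemma density_dens:
  "x \<in> reachable \<Longrightarrow> density (restr_to_subalg P F) (\<lambda>\<omega>. ennreal (dens x \<omega>)) =
    restr_to_subalg (distr P (path_space G) (translate x)) F"
  using someI_ex[OF dens_exists, of x] by (simp add: dens_def)

lemma measurable_dens_P [measurable]: "dens x \<in> borel_measurable (path_space G)"
  by (rule measurable_F_P[OF measurable_dens])

lemma nn_integral_dens:
  fixes H :: "(nat \<Rightarrow> 'a) \<Rightarrow> ennreal"
  assumes x: "x \<in> reachable" and H: "H \<in> borel_measurable F"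
  shows "(\<integral>\<^sup>+\<omega>. H \<omega> * dens x \<omega> \<partial>P) = (\<integral>\<^sup>+\<omega>. H (translate x \<omega>) \<partial>P)"
proof -
  let ?M = "restr_to_subalg P F"
  let ?D = "distr P (path_space G) (translate x)"
  have T: "translate x \<in> measurable P (path_space G)"
    using measurable_translate[OF reachable_carrier[OF x]] by (simp add: measurable_P_eq)
  have sub: "subalgebra ?D F"
    using subalgebra_F by (simp add: subalgebra_def)
  note [measurable] = H
  have "(\<integral>\<^sup>+\<omega>. H \<omega> * dens x \<omega> \<partial>P) = (\<integral>\<^sup>+\<omega>. dens x \<omega> * H \<omega> \<partial>?M)"
    by (subst nn_integral_subalgebra2[OF subalgebra_F]) (simp_all add: mult.commute)
  also have "\<dots> = (\<integral>\<^sup>+\<omega>. H \<omega> \<partial>density ?M (\<lambda>\<omega>. ennreal (dens x \<omega>)))"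
    by (subst nn_integral_density) (auto intro!: measurable_in_subalg[OF subalgebra_F])
  also have "\<dots> = (\<integral>\<^sup>+\<omega>. H \<omega> \<partial>?D)"
    unfolding density_dens[OF x] by (rule nn_integral_subalgebra2[OF sub H])
  also have "\<dots> = (\<integral>\<^sup>+\<omega>. H (translate x \<omega>) \<partial>P)"
    by (rule nn_integral_distr[OF T]) (simp add: measurable_F_P[OF H])
  finally show ?thesis .
qed

text \<open>In other words, the conditional probability of \<open>B\<close> given \<open>J\<close>
  is \<open>emeasure P B * dens x\<close>.\<close>

lemma nn_integral_past_dens:
  fixes H :: "(nat \<Rightarrow> 'a) \<Rightarrow> ennreal"
  assumes B: "past m B" "\<And>\<omega>. \<omega> \<in> B \<Longrightarrow> \<omega> m = x" and x: "x \<in> reachable"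
    and H: "H \<in> borel_measurable F"
  shows "(\<integral>\<^sup>+\<omega>. indicator B \<omega> * H \<omega> \<partial>P) = emeasure P B * (\<integral>\<^sup>+\<omega>. H \<omega> * dens x \<omega> \<partial>P)"
  using nn_integral_past_position[of m B x H] B reachable_carrier[OF x] H nn_integral_dens[OF x H]
  by simp

lemma AE_eq_F:
  fixes f g :: "(nat \<Rightarrow> 'a) \<Rightarrow> real"
  assumes f: "f \<in> borel_measurable F" and g: "g \<in> borel_measurable F"
    and nonneg: "\<And>\<omega>. 0 \<le> f \<omega>" "\<And>\<omega>. 0 \<le> g \<omega>"
    and eq: "\<And>A. A \<in> J \<Longrightarrow>
      (\<integral>\<^sup>+\<omega>. indicator A \<omega> * ennreal (f \<omega>) \<partial>P) = (\<integral>\<^sup>+\<omega>. indicator A \<omega> * ennreal (g \<omega>) \<partial>P)"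
  shows "AE \<omega> in P. f \<omega> = g \<omega>"
proof -
  let ?M = "restr_to_subalg P F"
  interpret M: prob_space ?M
    by (rule prob_space_restr_to_subalg[OF subalgebra_F prob_space_axioms])
  have [measurable]: "f \<in> borel_measurable ?M" "g \<in> borel_measurable ?M"
    by (rule measurable_in_subalg[OF subalgebra_F], fact)+
  have sets_M: "sets ?M = J" by (simp add: sets_restr_to_subalg[OF subalgebra_F])
  have "density ?M (\<lambda>\<omega>. ennreal (f \<omega>)) = density ?M (\<lambda>\<omega>. ennreal (g \<omega>))"
  proof (rule measure_eqI)
    fix A assume "A \<in> sets (density ?M (\<lambda>\<omega>. ennreal (f \<omega>)))"
    then have A: "A \<in> sets ?M" "A \<in> J" by (simp_all add: sets_M)
    have "emeasure (density ?M (\<lambda>\<omega>. ennreal (h \<omega>))) A = (\<integral>\<^sup>+\<omega>. indicator A \<omega> * ennreal (h \<omega>) \<partial>P)"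
      if [measurable]: "h \<in> borel_measurable F" for h :: "_ \<Rightarrow> real"
    proof -
      have [measurable]: "A \<in> sets F" using A by simp
      show ?thesis
        using A measurable_in_subalg[OF subalgebra_F that]
        by (subst nn_integral_subalgebra2[OF subalgebra_F, symmetric])
           (simp_all add: emeasure_density mult.commute)
    qed
    then show "emeasure (density ?M (\<lambda>\<omega>. ennreal (f \<omega>))) A = emeasure (density ?M (\<lambda>\<omega>. ennreal (g \<omega>))) A"
      using f g eq[OF A(2)] by simp
  qed simp
  then have "AE \<omega> in ?M. ennreal (f \<omega>) = ennreal (g \<omega>)"
    by (subst (asm) M.density_unique_iff) auto
  then have "AE \<omega> in P. ennreal (f \<omega>) = ennreal (g \<omega>)"
    by (rule AE_restr_to_subalg[OF subalgebra_F])
  then show ?thesis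
    by eventually_elim (simp add: nonneg)
qed

lemma dens_one: "AE \<omega> in P. dens \<one> \<omega> = 1"
proof (rule AE_eq_F)
  fix A assume A: "A \<in> J"
  then have [measurable]: "A \<in> sets F" by simp
  have "(\<integral>\<^sup>+\<omega>. indicator A \<omega> * ennreal (dens \<one> \<omega>) \<partial>P) = (\<integral>\<^sup>+\<omega>. indicator A (translate \<one> \<omega>) \<partial>P)"
    by (rule nn_integral_dens[OF one_reachable]) simp
  also have "\<dots> = (\<integral>\<^sup>+\<omega>. indicator A \<omega> * ennreal 1 \<partial>P)"
    by (intro nn_integral_cong) (simp add: translate_one)
  finally show "(\<integral>\<^sup>+\<omega>. indicator A \<omega> * ennreal (dens \<one> \<omega>) \<partial>P) = (\<integral>\<^sup>+\<omega>. indicator A \<omega> * ennreal 1 \<partial>P)" .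
qed (simp_all add: dens_nonneg)

text \<open>The cocycle identity. Integrated over a set of \<open>J\<close>, the right side
  undergoes the change of variables by \<open>x\<close> and then the one by \<open>y\<close>. The
  first is legitimate because translations preserve \<open>J\<close>, so the translated factor is
  again \<open>J\<close>-measurable.\<close>

lemma dens_mult:
  assumes x: "x \<in> reachable" and y: "y \<in> reachable"
  shows "AE \<omega> in P. dens (x \<otimes> y) \<omega> = dens x \<omega> * dens y (translate (inv x) \<omega>)"
proof (rule AE_eq_F)
  note xc = reachable_carrier[OF x] and yc = reachable_carrier[OF y]
  have Tx: "translate x \<in> measurable F F" and Tx': "translate (inv x) \<in> measurable F F"
    using xc by (auto intro: measurable_translate_F)
  have dy[measurable]: "(\<lambda>\<omega>. dens y (translate (inv x) \<omega>)) \<in> borel_measurable F"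
    by (rule measurable_compose[OF Tx' measurable_dens])
  show "(\<lambda>\<omega>. dens x \<omega> * dens y (translate (inv x) \<omega>)) \<in> borel_measurable F"
    by measurable
  fix A assume "A \<in> J"
  then have [measurable]: "A \<in> sets F" by simp
  have iA: "(\<lambda>\<omega>. indicator A (translate x \<omega>) :: ennreal) \<in> borel_measurable F"
    by (rule measurable_compose[OF Tx]) simp
  have "(\<integral>\<^sup>+\<omega>. indicator A \<omega> * ennreal (dens x \<omega> * dens y (translate (inv x) \<omega>)) \<partial>P) =
      (\<integral>\<^sup>+\<omega>. (indicator A \<omega> * ennreal (dens y (translate (inv x) \<omega>))) * ennreal (dens x \<omega>) \<partial>P)"
    by (simp add: ennreal_mult dens_nonneg mult_ac)
  also have "\<dots> = (\<integral>\<^sup>+\<omega>. indicator A (translate x \<omega>) *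
      ennreal (dens y (translate (inv x) (translate x \<omega>))) \<partial>P)"
    by (rule nn_integral_dens[OF x]) simp
  also have "\<dots> = (\<integral>\<^sup>+\<omega>. indicator A (translate x \<omega>) * ennreal (dens y \<omega>) \<partial>P)"
    using xc by (intro nn_integral_cong) (simp add: translate_translate translate_one)
  also have "\<dots> = (\<integral>\<^sup>+\<omega>. indicator A (translate x (translate y \<omega>)) \<partial>P)"
    by (rule nn_integral_dens[OF y iA])
  also have "\<dots> = (\<integral>\<^sup>+\<omega>. indicator A (translate (x \<otimes> y) \<omega>) \<partial>P)"
    using xc yc by (intro nn_integral_cong) (simp add: translate_translate)
  also have "\<dots> = (\<integral>\<^sup>+\<omega>. indicator A \<omega> * ennreal (dens (x \<otimes> y) \<omega>) \<partial>P)"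
    by (rule nn_integral_dens[OF mult_reachable[OF x y], symmetric]) simp
  finally show "(\<integral>\<^sup>+\<omega>. indicator A \<omega> * ennreal (dens (x \<otimes> y) \<omega>) \<partial>P) =
      (\<integral>\<^sup>+\<omega>. indicator A \<omega> * ennreal (dens x \<omega> * dens y (translate (inv x) \<omega>)) \<partial>P)" by simp
qed (simp_all add: dens_nonneg)

text \<open>\<open>position_prob m x * dens x\<close> is the conditional probability of being at \<open>x\<close> at time \<open>m\<close>
  given \<open>J\<close>.\<close>

lemma nn_integral_position:
  fixes H :: "'a \<Rightarrow> (nat \<Rightarrow> 'a) \<Rightarrow> ennreal"
  assumes H: "\<And>x. x \<in> carrier G \<Longrightarrow> H x \<in> borel_measurable F"
  shows "(\<integral>\<^sup>+\<omega>. H (\<omega> m) \<omega> \<partial>P) =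
    (\<integral>\<^sup>+x. ennreal (position_prob m x) * (\<integral>\<^sup>+\<omega>. H x \<omega> * dens x \<omega> \<partial>P) \<partial>count_space (carrier G))"
proof -
  let ?B = "\<lambda>x. {\<omega> \<in> space P. \<omega> m = x}"
  have HP: "H x \<in> borel_measurable (path_space G)" if "x \<in> carrier G" for x
    by (rule measurable_F_P[OF H[OF that]])
  have "(\<integral>\<^sup>+\<omega>. H (\<omega> m) \<omega> \<partial>P) = (\<integral>\<^sup>+\<omega>. (\<integral>\<^sup>+x. indicator (?B x) \<omega> * H x \<omega> \<partial>count_space (carrier G)) \<partial>P)"
  proof (intro nn_integral_cong)
    fix \<omega> assume \<omega>: "\<omega> \<in> space P"
    then have c: "\<omega> m \<in> carrier G" by (simp add: space_path_space)
    have "(\<integral>\<^sup>+x. indicator (?B x) \<omega> * H x \<omega> \<partial>count_space (carrier G)) =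
        (\<integral>\<^sup>+x. H x \<omega> * indicator {\<omega> m} x \<partial>count_space (carrier G))"
      using \<omega> by (intro nn_integral_cong) (auto simp: indicator_def)
    also have "\<dots> = H (\<omega> m) \<omega>"
      using c by (subst nn_integral_indicator_singleton) auto
    finally show "H (\<omega> m) \<omega> = (\<integral>\<^sup>+x. indicator (?B x) \<omega> * H x \<omega> \<partial>count_space (carrier G))" by simp
  qed
  also have "\<dots> = (\<integral>\<^sup>+x. (\<integral>\<^sup>+\<omega>. indicator (?B x) \<omega> * H x \<omega> \<partial>P) \<partial>count_space (carrier G))"
    using HP by (intro nn_integral_count_space_nn_integral countable_carrier) auto
  also have "\<dots> = (\<integral>\<^sup>+x. ennreal (position_prob m x) * (\<integral>\<^sup>+\<omega>. H x \<omega> * dens x \<omega> \<partial>P) \<partial>count_space (carrier G))"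
  proof (intro nn_integral_cong)
    fix x assume "x \<in> space (count_space (carrier G))"
    then have x: "x \<in> carrier G" by simp
    have "(\<integral>\<^sup>+\<omega>. indicator (?B x) \<omega> * H x \<omega> \<partial>P) = emeasure P (?B x) * (\<integral>\<^sup>+\<omega>. H x (translate x \<omega>) \<partial>P)"
      by (rule nn_integral_past_position[OF past_position]) (use x H in auto)
    moreover have "emeasure P (?B x) = ennreal (position_prob m x)"
      by (simp add: position_prob_def emeasure_eq_measure)
    \<comment> \<open>For a point not charged at time \<open>m\<close> both sides have weight 0, so
      the density may take any value there.\<close>
    moreover have "(\<integral>\<^sup>+\<omega>. H x (translate x \<omega>) \<partial>P) = (\<integral>\<^sup>+\<omega>. H x \<omega> * dens x \<omega> \<partial>P)"
      if "position_prob m x > 0"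
      using that x H by (subst nn_integral_dens) (auto simp: reachable_def)
    ultimately show "(\<integral>\<^sup>+\<omega>. indicator (?B x) \<omega> * H x \<omega> \<partial>P) =
        ennreal (position_prob m x) * (\<integral>\<^sup>+\<omega>. H x \<omega> * dens x \<omega> \<partial>P)"
      using position_prob_nonneg[of m x] by (cases "position_prob m x = 0") auto
  qed
  finally show ?thesis .
qed

end

section \<open>Comparison with the full invariant field\<close>

lemma (in random_walk) walk_field_invariant_sets: "walk_field G \<mu> P (invariant_sets G)"
  by (intro walk_field.intro random_walk_axioms walk_field_axioms.intro
      sigma_algebra_invariant_sets group_closed_invariant_sets is_group order_refl)

context walk_field
begin

lemma AE_reachable: "AE \<omega> in P. \<omega> m \<in> reachable"
  by (rule AE_at_position) (auto simp: reachable_def)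

lemma measurable_at_position:
  assumes "\<And>x. x \<in> carrier G \<Longrightarrow> f x \<in> measurable (path_space G) N"
  shows "(\<lambda>\<omega>. f (\<omega> m) \<omega>) \<in> measurable (path_space G) N"
  by (rule measurable_compose_countable'[OF assms measurable_path_coord countable_carrier])

text \<open>The cocycle identity at the random pair \<open>\<omega> 1\<close>,
  \<open>recentre 1 \<omega> m\<close>, whose product is the position at time \<open>Suc m\<close>.
  Countability of \<open>reachable\<close> gives one null set for all pairs, and translation back by
  the first step turns into recentring.\<close>

lemma dens_step:
  "AE \<omega> in P. dens (\<omega> (Suc m)) \<omega> = dens (\<omega> 1) \<omega> * dens (recentre 1 \<omega> m) (recentre 1 \<omega>)"
proof -
  have count: "countable reachable"
    by (rule countable_subset[OF _ countable_carrier]) (auto simp: reachable_def)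
  have cocycle: "AE \<omega> in P. \<forall>x\<in>reachable. \<forall>y\<in>reachable.
      dens (x \<otimes> y) \<omega> = dens x \<omega> * dens y (translate (inv x) \<omega>)"
    using dens_mult by (simp add: AE_ball_countable[OF count])
  have "AE \<omega> in P. recentre 1 \<omega> m \<in> reachable"
    by (rule AE_recentre[OF _ AE_reachable]) (auto intro: measurable_at_position)
  then show ?thesis
    using cocycle AE_reachable[of 1] AE_space
  proof eventually_elim
    case (elim \<omega>)
    then have c: "\<omega> i \<in> carrier G" for i by (simp add: space_path_space)
    have "\<omega> 1 \<otimes> recentre 1 \<omega> m = \<omega> (Suc m)"
      using c by (simp add: recentre_def m_assoc[symmetric])
    moreover have "dens y (recentre 1 \<omega>) = dens y (translate (inv (\<omega> 1)) \<omega>)" for y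
      using elim by (intro borel_F_recentre[OF measurable_dens]) simp
    ultimately show ?case using elim by metis
  qed
qed

text \<open>A conditional probability cannot exceed 1. On the set \<open>A\<close> where the bound
  fails, the function integrates to at most the measure of \<open>A\<close>; that measure is finite
  and cancels, leaving a zero integral for the positive excess.\<close>

lemma position_prob_dens_le_1:
  assumes x: "x \<in> reachable"
  shows "AE \<omega> in P. position_prob m x * dens x \<omega> \<le> 1"
proof -
  define r where "r = position_prob m x"
  have r: "0 \<le> r" by (simp add: r_def position_prob_nonneg)
  define A where "A = {\<omega> \<in> space F. 1 < r * dens x \<omega>}"
  have A[measurable]: "A \<in> sets F" unfolding A_def by measurable
  have AP[measurable]: "A \<in> sets P"
    using A subalgebra_F by (auto simp: subalgebra_def)
  let ?g = "\<lambda>\<omega>. indicator A \<omega> * ennreal (r * dens x \<omega> - 1)"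
  have "(\<integral>\<^sup>+\<omega>. ?g \<omega> \<partial>P) + emeasure P A = (\<integral>\<^sup>+\<omega>. ?g \<omega> + indicator A \<omega> \<partial>P)"
    by (subst nn_integral_add) (auto simp: nn_integral_indicator[OF AP])
  also have "\<dots> = (\<integral>\<^sup>+\<omega>. ennreal r * (indicator A \<omega> * ennreal (dens x \<omega>)) \<partial>P)"
  proof (intro nn_integral_cong)
    fix \<omega>
    have "ennreal (r * dens x \<omega> - 1) + 1 = ennreal r * ennreal (dens x \<omega>)" if "1 < r * dens x \<omega>"
      using that r dens_nonneg[of x \<omega>]
      by (simp flip: ennreal_plus ennreal_1 ennreal_mult)
    then show "?g \<omega> + indicator A \<omega> = ennreal r * (indicator A \<omega> * ennreal (dens x \<omega>))"
      by (auto simp: indicator_def A_def)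
  qed
  also have "\<dots> = ennreal r * (\<integral>\<^sup>+\<omega>. indicator A \<omega> * ennreal (dens x \<omega>) \<partial>P)"
    by (rule nn_integral_cmult) auto
  also have "\<dots> = (\<integral>\<^sup>+\<omega>. indicator {\<omega> \<in> space P. \<omega> m = x} \<omega> * indicator A \<omega> \<partial>P)"
    using x by (subst nn_integral_past_dens[OF past_position])
      (auto simp: r_def position_prob_def emeasure_eq_measure)
  also have "\<dots> \<le> (\<integral>\<^sup>+\<omega>. indicator A \<omega> \<partial>P)"
    by (intro nn_integral_mono) (auto simp: indicator_def)
  finally have "(\<integral>\<^sup>+\<omega>. ?g \<omega> \<partial>P) + emeasure P A \<le> 0 + emeasure P A"
    using nn_integral_indicator[OF AP] by simp
  then have "(\<integral>\<^sup>+\<omega>. ?g \<omega> \<partial>P) = 0"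
    by (simp add: emeasure_eq_measure ennreal_add_left_cancel_le add.commute)
  then have "AE \<omega> in P. ?g \<omega> = 0"
    by (subst (asm) nn_integral_0_iff_AE) auto
  then show ?thesis
    using AE_space
    by eventually_elim (auto simp: A_def indicator_def r_def[symmetric] ennreal_eq_0_iff split: if_splits)
qed

text \<open>The probability of standing at a point where its density vanishes is a weighted sum of
  integrals of each density over its own zero set.\<close>

lemma AE_dens_pos: "AE \<omega> in P. 0 < dens (\<omega> m) \<omega>"
proof -
  define Z where "Z x = {\<omega> \<in> space F. dens x \<omega> = 0}" for x
  have Z: "Z x \<in> sets F" for x unfolding Z_def by measurable
  then have ZP: "Z x \<in> sets (path_space G)" for x
    using subalgebra_F by (auto simp: subalgebra_def)
  let ?H = "\<lambda>x \<omega>. indicator (Z x) \<omega> :: ennreal"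
  have "(\<integral>\<^sup>+\<omega>. ?H (\<omega> m) \<omega> \<partial>P) =
      (\<integral>\<^sup>+x. ennreal (position_prob m x) * (\<integral>\<^sup>+\<omega>. ?H x \<omega> * dens x \<omega> \<partial>P) \<partial>count_space (carrier G))"
    by (rule nn_integral_position) (rule borel_measurable_indicator[OF Z])
  also have "\<dots> = (\<integral>\<^sup>+x. 0 \<partial>count_space (carrier G))"
  proof (intro nn_integral_cong)
    fix x
    have "(\<integral>\<^sup>+\<omega>. ?H x \<omega> * dens x \<omega> \<partial>P) = (\<integral>\<^sup>+\<omega>. 0 \<partial>P)"
      by (intro nn_integral_cong) (auto simp: indicator_def Z_def)
    then show "ennreal (position_prob m x) * (\<integral>\<^sup>+\<omega>. ?H x \<omega> * dens x \<omega> \<partial>P) = 0" by simp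
  qed
  finally have "(\<integral>\<^sup>+\<omega>. ?H (\<omega> m) \<omega> \<partial>P) = 0" by simp
  then have "AE \<omega> in P. ?H (\<omega> m) \<omega> = 0"
    by (subst (asm) nn_integral_0_iff_AE)
       (auto simp: measurable_P_eq intro!: measurable_at_position[of ?H] borel_measurable_indicator ZP)
  then show ?thesis
    using AE_space
  proof eventually_elim
    case (elim \<omega>)
    then have "dens (\<omega> m) \<omega> \<noteq> 0" by (auto simp: indicator_def Z_def)
    then show ?case using dens_nonneg[of "\<omega> m" \<omega>] by simp
  qed
qed

section \<open>The ratio of the densities on \<open>J\<close> and on the full invariant
  field\<close>

interpretation inv: walk_field G \<mu> P "invariant_sets G"
  by (rule walk_field_invariant_sets)

lemma subalgebra_inv_F: "subalgebra inv.F F"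
  using J_invariant by (simp add: subalgebra_def)

lemma measurable_F_inv: "f \<in> measurable F N \<Longrightarrow> f \<in> measurable inv.F N"
  by (rule measurable_from_subalg[OF subalgebra_inv_F])

text \<open>Division by zero yields 0, so multiplying back by the denominator never exceeds
  \<open>dens x\<close>. At visited positions the denominator is almost surely positive.\<close>

definition dens_ratio :: "'a \<Rightarrow> (nat \<Rightarrow> 'a) \<Rightarrow> real" where
  "dens_ratio x \<omega> = dens x \<omega> / walk_field.dens G P (invariant_sets G) x \<omega>"

lemma dens_ratio_nonneg: "0 \<le> dens_ratio x \<omega>"
  by (simp add: dens_ratio_def dens_nonneg inv.dens_nonneg)

lemma measurable_dens_ratio: "dens_ratio x \<in> borel_measurable inv.F"
  unfolding dens_ratio_def[abs_def]
  using measurable_F_inv[OF measurable_dens] by measurable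

lemma measurable_dens_ratio_position [measurable]:
  "(\<lambda>\<omega>. dens_ratio (\<omega> m) \<omega>) \<in> borel_measurable (path_space G)"
  by (rule measurable_at_position) (rule inv.measurable_F_P[OF measurable_dens_ratio])

definition step_ratio :: "(nat \<Rightarrow> 'a) \<Rightarrow> real" where
  "step_ratio \<omega> = dens_ratio (\<omega> 1) \<omega>"

lemma step_ratio_nonneg: "0 \<le> step_ratio \<omega>"
  by (simp add: step_ratio_def dens_ratio_nonneg)

lemma measurable_step_ratio [measurable]: "step_ratio \<in> borel_measurable (path_space G)"
  unfolding step_ratio_def[abs_def] by (rule measurable_dens_ratio_position)

text \<open>Expanding over the first position weights the ratio by the denominator and leaves at
  most the conditional probabilities given \<open>J\<close>, which sum to 1. Mass is lost where the
  denominator vanishes and the numerator does not, hence only an inequality.\<close>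

lemma nn_integral_step_ratio: "(\<integral>\<^sup>+\<omega>. ennreal (step_ratio \<omega>) \<partial>P) \<le> 1"
proof -
  have "(\<integral>\<^sup>+\<omega>. ennreal (step_ratio \<omega>) \<partial>P) =
      (\<integral>\<^sup>+x. ennreal (position_prob 1 x) *
        (\<integral>\<^sup>+\<omega>. ennreal (dens_ratio x \<omega>) * inv.dens x \<omega> \<partial>P) \<partial>count_space (carrier G))"
    unfolding step_ratio_def using measurable_dens_ratio
    by (intro inv.nn_integral_position) auto
  also have "\<dots> \<le> (\<integral>\<^sup>+x. ennreal (position_prob 1 x) * (\<integral>\<^sup>+\<omega>. 1 * ennreal (dens x \<omega>) \<partial>P) \<partial>count_space (carrier G))"
  proof -
    have "ennreal (dens_ratio x \<omega>) * ennreal (inv.dens x \<omega>) = ennreal (dens_ratio x \<omega> * inv.dens x \<omega>)" for x \<omega>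
      by (simp add: ennreal_mult dens_ratio_nonneg inv.dens_nonneg)
    moreover have "ennreal (dens_ratio x \<omega> * inv.dens x \<omega>) \<le> ennreal (dens x \<omega>)" for x \<omega>
      by (intro ennreal_leI) (simp add: dens_ratio_def dens_nonneg)
    ultimately have "ennreal (dens_ratio x \<omega>) * ennreal (inv.dens x \<omega>) \<le> 1 * ennreal (dens x \<omega>)" for x \<omega>
      by simp
    then show ?thesis by (intro nn_integral_mono mult_left_mono) auto
  qed
  also have "\<dots> = (\<integral>\<^sup>+\<omega>. 1 \<partial>P)"
    by (rule nn_integral_position[symmetric]) simp
  finally show ?thesis by (simp add: emeasure_space_1[simplified])
qed

text \<open>Both densities are cocycles, so the first step splits off from the ratio; stationarity
  transports the induction hypothesis to the recentred path.\<close>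

lemma dens_ratio_prod:
  "AE \<omega> in P. dens_ratio (\<omega> (Suc m)) \<omega> = (\<Prod>k<Suc m. step_ratio (recentre k \<omega>))"
proof (induction m)
  case 0
  show ?case
    using AE_recentre_0 by eventually_elim (simp add: step_ratio_def)
next
  case (Suc m)
  have "AE \<omega> in P. dens_ratio (recentre 1 \<omega> (Suc m)) (recentre 1 \<omega>) =
      (\<Prod>k<Suc m. step_ratio (recentre k (recentre 1 \<omega>)))"
  proof (rule AE_recentre[OF _ Suc])
    have "(\<lambda>\<omega>. \<Prod>k<Suc m. step_ratio (recentre k \<omega>)) \<in> borel_measurable (path_space G)"
      by measurable
    then show "Measurable.pred (path_space G)
        (\<lambda>\<omega>. dens_ratio (\<omega> (Suc m)) \<omega> = (\<Prod>k<Suc m. step_ratio (recentre k \<omega>)))"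
      using borel_measurable_eq[OF measurable_dens_ratio_position[of "Suc m"]] by (simp add: pred_def)
  qed
  then show ?case
    using AE_recentre_0 dens_step[of "Suc m"] inv.dens_step[of "Suc m"] AE_space
  proof eventually_elim
    case (elim \<omega>)
    have "dens_ratio (\<omega> (Suc (Suc m))) \<omega> =
        step_ratio \<omega> * dens_ratio (recentre 1 \<omega> (Suc m)) (recentre 1 \<omega>)"
      unfolding dens_ratio_def step_ratio_def elim(3) elim(4) by simp
    also have "\<dots> = step_ratio (recentre 0 \<omega>) * (\<Prod>k<Suc m. step_ratio (recentre (Suc k) \<omega>))"
      using elim by (simp add: recentre_recentre del: prod.lessThan_Suc)
    also have "\<dots> = (\<Prod>k<Suc (Suc m). step_ratio (recentre k \<omega>))"
      by (rule prod.lessThan_Suc_shift[symmetric])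
    finally show ?case .
  qed
qed

lemma position_prob_dens_le_ratio:
  "AE \<omega> in P. position_prob m (\<omega> m) * dens (\<omega> m) \<omega> \<le> dens_ratio (\<omega> m) \<omega>"
proof -
  have "AE \<omega> in P. position_prob m (\<omega> m) * inv.dens (\<omega> m) \<omega> \<le> 1"
  proof (rule AE_at_position[where Q = "\<lambda>x \<omega>. position_prob m x * inv.dens x \<omega> \<le> 1"])
    fix x assume "x \<in> carrier G" "0 < position_prob m x"
    then have "x \<in> reachable" by (auto simp: reachable_def)
    from inv.position_prob_dens_le_1[OF this, of m]
    show "AE \<omega> in P. \<omega> m = x \<longrightarrow> position_prob m x * inv.dens x \<omega> \<le> 1"
      by eventually_elim simp
  qed
  then show ?thesis
    using inv.AE_dens_pos[of m]
  proof eventually_elim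
    case (elim \<omega>)
    then have "position_prob m (\<omega> m) \<le> 1 / inv.dens (\<omega> m) \<omega>"
      by (simp add: field_simps)
    then have "position_prob m (\<omega> m) * dens (\<omega> m) \<omega> \<le> 1 / inv.dens (\<omega> m) \<omega> * dens (\<omega> m) \<omega>"
      by (rule mult_right_mono) (rule dens_nonneg)
    then show ?case by (simp add: dens_ratio_def)
  qed
qed

text \<open>With u the ratio and s its square root, (1 - s)^2 = 2 (1 - s) - (1 - u). Since u has
  mean at most 1, the drift is at least half the mean of (1 - s)^2, which vanishes only if u = 1
  almost surely. The square root is integrable as soon as u is.\<close>

lemma step_ratio_drift:
  assumes ne: "\<not> (AE \<omega> in P. step_ratio \<omega> = 1)"
  shows "integrable P (\<lambda>\<omega>. 1 - sqrt (step_ratio \<omega>))"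
    and "0 < (\<integral>\<omega>. 1 - sqrt (step_ratio \<omega>) \<partial>P)"
proof -
  let ?s = "\<lambda>\<omega>. sqrt (step_ratio \<omega>)"
  have u: "integrable P step_ratio"
    using nn_integral_step_ratio
    by (intro integrableI_nonneg) (auto simp: step_ratio_nonneg measurable_P_eq elim: le_less_trans)
  have "ennreal (\<integral>\<omega>. step_ratio \<omega> \<partial>P) \<le> 1"
    using nn_integral_step_ratio u by (subst nn_integral_eq_integral[symmetric]) (auto simp: step_ratio_nonneg)
  then have Eu: "(\<integral>\<omega>. step_ratio \<omega> \<partial>P) \<le> 1"
    by (simp add: ennreal_le_1)
  have s_le: "?s \<omega> \<le> 1 + step_ratio \<omega>" for \<omega>
    using sum_squares_bound[of 1 "?s \<omega>"] step_ratio_nonneg[of \<omega>]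
    by (simp add: power2_eq_square)
  have s: "integrable P ?s"
    by (rule Bochner_Integration.integrable_bound[of _ "\<lambda>\<omega>. 1 + step_ratio \<omega>"])
      (use u s_le step_ratio_nonneg in \<open>auto simp: measurable_P_eq\<close>)
  then show "integrable P (\<lambda>\<omega>. 1 - ?s \<omega>)" by simp
  have sq: "(1 - ?s \<omega>)\<^sup>2 = 2 * (1 - ?s \<omega>) - (1 - step_ratio \<omega>)" for \<omega>
    using step_ratio_nonneg[of \<omega>] by (simp add: power2_eq_square algebra_simps)
  have int: "integrable P (\<lambda>\<omega>. (1 - ?s \<omega>)\<^sup>2)"
    unfolding sq using u s by simp
  have "(\<integral>\<omega>. (1 - ?s \<omega>)\<^sup>2 \<partial>P) \<noteq> 0"
  proof
    assume "(\<integral>\<omega>. (1 - ?s \<omega>)\<^sup>2 \<partial>P) = 0"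
    then have "AE \<omega> in P. (1 - ?s \<omega>)\<^sup>2 = 0"
      using int by (subst (asm) integral_nonneg_eq_0_iff_AE) auto
    then have "AE \<omega> in P. step_ratio \<omega> = 1" by eventually_elim simp
    then show False using ne by blast
  qed
  moreover have "0 \<le> (\<integral>\<omega>. (1 - ?s \<omega>)\<^sup>2 \<partial>P)" by simp
  moreover have "(\<integral>\<omega>. (1 - ?s \<omega>)\<^sup>2 \<partial>P) = 2 * (\<integral>\<omega>. 1 - ?s \<omega> \<partial>P) - (1 - (\<integral>\<omega>. step_ratio \<omega> \<partial>P))"
    unfolding sq using u s by (simp add: prob_space)
  ultimately show "0 < (\<integral>\<omega>. 1 - ?s \<omega> \<partial>P)"
    using Eu by linarith
qed

text \<open>From sqrt u = 1 - w \<le> exp (- w) each factor u is at most exp (- 2 w). The Birkhoff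
  sums of w grow at least linearly up to an additive constant, so the product of the factors decays
  exponentially.\<close>

lemma conditional_prob_decay:
  assumes ne: "\<not> (AE \<omega> in P. step_ratio \<omega> = 1)"
  shows "\<exists>c>0. AE \<omega> in P. \<forall>\<^sub>F m in sequentially.
    position_prob m (\<omega> m) * dens (\<omega> m) \<omega> \<le> exp (- (c * real m))"
proof -
  define w where "w \<omega> = 1 - sqrt (step_ratio \<omega>)" for \<omega>
  have w: "integrable P w" "0 < (\<integral>\<omega>. w \<omega> \<partial>P)"
    using step_ratio_drift[OF ne] by (simp_all add: w_def[abs_def])
  \<comment> \<open>Half the mean is positive and strictly below the mean, as the ergodic lower
    bound requires.\<close>
  define c where "c = (\<integral>\<omega>. w \<omega> \<partial>P) / 2"
  have c: "0 < c" "c < (\<integral>\<omega>. w \<omega> \<partial>P)" using w(2) by (simp_all add: c_def)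
  have u_le: "step_ratio \<omega> \<le> exp (- 2 * w \<omega>)" for \<omega>
  proof -
    have "sqrt (step_ratio \<omega>) \<le> exp (- w \<omega>)"
      using exp_ge_add_one_self[of "- w \<omega>"] by (simp add: w_def)
    then have "(sqrt (step_ratio \<omega>))\<^sup>2 \<le> (exp (- w \<omega>))\<^sup>2"
      by (intro power_mono) (simp_all add: step_ratio_nonneg)
    then show ?thesis
      by (simp add: step_ratio_nonneg power2_eq_square flip: exp_add)
  qed
  have "AE \<omega> in P. \<forall>m. dens_ratio (\<omega> (Suc m)) \<omega> = (\<Prod>k<Suc m. step_ratio (recentre k \<omega>))"
    using dens_ratio_prod by (simp only: AE_all_countable) blast
  moreover have "AE \<omega> in P. \<forall>m. position_prob m (\<omega> m) * dens (\<omega> m) \<omega> \<le> dens_ratio (\<omega> m) \<omega>"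
    using position_prob_dens_le_ratio by (simp only: AE_all_countable) blast
  ultimately have "AE \<omega> in P. \<forall>\<^sub>F m in sequentially.
      position_prob m (\<omega> m) * dens (\<omega> m) \<omega> \<le> exp (- (c * real m))"
    using ergodic_lower_bound[OF w(1) c(2)]
  proof eventually_elim
    case (elim \<omega>)
    then obtain K where K: "\<And>m. c * real m - K \<le> (\<Sum>k<m. w (recentre k \<omega>))" by blast
    have "position_prob m (\<omega> m) * dens (\<omega> m) \<omega> \<le> exp (- (c * real m))"
      if m: "nat \<lceil>2 * K / c\<rceil> \<le> m" "1 \<le> m" for m
    proof -
      obtain m' where m': "m = Suc m'" using m(2) by (cases m) auto
      \<comment> \<open>The exponent available is - 2 (c m - K), so for such \<open>m\<close> one of
        the two copies of c m absorbs the random constant. The other condition on \<open>m\<close>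
        is there because the product formula concerns positive times.\<close>
      have "2 * K \<le> c * real m"
        using m(1) c(1) by (simp add: nat_le_iff ceiling_le_iff field_simps)
      have "position_prob m (\<omega> m) * dens (\<omega> m) \<omega> \<le> (\<Prod>k<m. step_ratio (recentre k \<omega>))"
        using elim(1,2) m' by metis
      also have "\<dots> \<le> (\<Prod>k<m. exp (- 2 * w (recentre k \<omega>)))"
  using u_le by (intro prod_mono) (simp add: step_ratio_nonneg)
      also have "\<dots> = exp (- 2 * (\<Sum>k<m. w (recentre k \<omega>)))"
        by (simp add: exp_sum sum_distrib_left)
      also have "\<dots> \<le> exp (- (c * real m))"
        using K[of m] \<open>2 * K \<le> c * real m\<close> by simp
      finally show ?thesis .
    qed
    then show ?case
      unfolding eventually_sequentially
      by (intro exI[of _ "max 1 (nat \<lceil>2 * K / c\<rceil>)"]) auto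
  qed
  then show ?thesis using c(1) by blast
qed

text \<open>A ratio of 1 gives equality only on the event of being at \<open>x\<close>. Given the
  full invariant field, that event has probability proportional to \<open>inv.dens x\<close>, so the
  densities can differ only where \<open>inv.dens x\<close> vanishes. Hence
  \<open>inv.dens x \<le> dens x\<close>, and equal total mass gives equality.\<close>

lemma dens_eq_inv_dens:
  assumes eq: "AE \<omega> in P. step_ratio \<omega> = 1" and x: "x \<in> reachable"
  shows "AE \<omega> in P. dens x \<omega> = inv.dens x \<omega>"
proof -
  obtain m where m: "position_prob m x > 0" using x by (auto simp: reachable_def)
  have at: "AE \<omega> in P. dens (\<omega> m) \<omega> = inv.dens (\<omega> m) \<omega>"
  proof (cases m)
    case 0
    show ?thesis
      using AE_start dens_one inv.dens_one by eventually_elim (simp add: 0)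
  next
    case (Suc m')
    have "AE \<omega> in P. step_ratio (recentre k \<omega>) = 1" for k
      by (rule AE_recentre[OF _ eq]) measurable
    then have "AE \<omega> in P. \<forall>k. step_ratio (recentre k \<omega>) = 1"
      by (simp add: AE_all_countable)
    then show ?thesis
      using dens_ratio_prod[of m'] inv.AE_dens_pos[of m]
    proof eventually_elim
      case (elim \<omega>)
      then have "dens_ratio (\<omega> m) \<omega> = 1" by (simp add: Suc)
      then show ?case using elim(3) by (simp add: dens_ratio_def)
    qed
  qed
  let ?B = "{\<omega> \<in> space P. \<omega> m = x}"
  define D where "D = {\<omega> \<in> space inv.F. dens x \<omega> \<noteq> inv.dens x \<omega>}"
  have [measurable]: "dens x \<in> borel_measurable inv.F"
    by (rule measurable_F_inv) simp
  have D[measurable]: "D \<in> sets inv.F" unfolding D_def by (rule borel_measurable_neq) simp_all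
  have "D \<in> invariant_sets G" using D by simp
  then have [measurable]: "D \<in> sets (path_space G)" by (simp add: invariant_sets_def)
  have "(\<integral>\<^sup>+\<omega>. indicator ?B \<omega> * indicator D \<omega> \<partial>P) = (\<integral>\<^sup>+\<omega>. 0 \<partial>P)"
    using at by (intro nn_integral_cong_AE) (auto simp: D_def indicator_def elim!: AE_mp)
  moreover have "(\<integral>\<^sup>+\<omega>. indicator ?B \<omega> * indicator D \<omega> \<partial>P) =
      emeasure P ?B * (\<integral>\<^sup>+\<omega>. indicator D \<omega> * ennreal (inv.dens x \<omega>) \<partial>P)"
    using x by (intro inv.nn_integral_past_dens[OF past_position]) auto
  ultimately have "(\<integral>\<^sup>+\<omega>. indicator D \<omega> * ennreal (inv.dens x \<omega>) \<partial>P) = 0"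
    using m by (simp add: position_prob_def emeasure_eq_measure)
  then have "AE \<omega> in P. indicator D \<omega> * ennreal (inv.dens x \<omega>) = 0"
    by (subst (asm) nn_integral_0_iff_AE) auto
  then have le: "AE \<omega> in P. inv.dens x \<omega> \<le> dens x \<omega>"
    using AE_space
  proof eventually_elim
    case (elim \<omega>)
    then show ?case
      using dens_nonneg[of x \<omega>] by (cases "\<omega> \<in> D") (auto simp: D_def ennreal_eq_0_iff)
  qed
  have one: "(\<integral>\<^sup>+\<omega>. ennreal (dens x \<omega>) \<partial>P) = 1" "(\<integral>\<^sup>+\<omega>. ennreal (inv.dens x \<omega>) \<partial>P) = 1"
    using nn_integral_dens[OF x, of "\<lambda>_. 1"] inv.nn_integral_dens[OF x, of "\<lambda>_. 1"]
    by (simp_all add: emeasure_space_1[simplified])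
  have "(\<integral>\<^sup>+\<omega>. ennreal (dens x \<omega> - inv.dens x \<omega>) \<partial>P) + (\<integral>\<^sup>+\<omega>. ennreal (inv.dens x \<omega>) \<partial>P) =
      (\<integral>\<^sup>+\<omega>. ennreal (dens x \<omega> - inv.dens x \<omega>) + ennreal (inv.dens x \<omega>) \<partial>P)"
    by (rule nn_integral_add[symmetric]) (auto simp: measurable_P_eq)
  also have "\<dots> = (\<integral>\<^sup>+\<omega>. ennreal (dens x \<omega>) \<partial>P)"
    using le by (intro nn_integral_cong_AE)
      (auto elim!: AE_mp simp flip: ennreal_plus simp: inv.dens_nonneg)
  finally have "(\<integral>\<^sup>+\<omega>. ennreal (dens x \<omega> - inv.dens x \<omega>) \<partial>P) + 1 \<le> 0 + 1"
    by (simp add: one)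
  then have "(\<integral>\<^sup>+\<omega>. ennreal (dens x \<omega> - inv.dens x \<omega>) \<partial>P) = 0"
    by (simp add: ennreal_add_left_cancel_le add.commute)
  then have "AE \<omega> in P. ennreal (dens x \<omega> - inv.dens x \<omega>) = 0"
    by (subst (asm) nn_integral_0_iff_AE) (auto simp: measurable_P_eq)
  with le show ?thesis
    by eventually_elim (simp add: ennreal_eq_0_iff)
qed

text \<open>Integrating an invariant function over a cylinder ending at \<open>x n\<close> weights
  it by the density at \<open>x n\<close>. As this density is now the same for both fields, the
  indicator of \<open>A\<close> and its conditional expectation \<phi> cannot be told apart by
  cylinders, so they agree almost surely.\<close>

lemma invariant_set_approx:
  assumes eq: "AE \<omega> in P. step_ratio \<omega> = 1" and A: "A \<in> invariant_sets G"
  shows "\<exists>B\<in>J. AE \<omega> in P. \<omega> \<in> A \<longleftrightarrow> \<omega> \<in> B"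
proof -
  interpret fs: finite_measure_subalgebra P F
    by unfold_locales (rule subalgebra_F)
  define \<phi> where "\<phi> = nn_cond_exp P F (indicator A)"
  have \<phi>[measurable]: "\<phi> \<in> borel_measurable F" unfolding \<phi>_def by measurable
  have \<phi>P[measurable]: "\<phi> \<in> borel_measurable (path_space G)" by (rule measurable_F_P[OF \<phi>])
  have [measurable]: "A \<in> sets (path_space G)" using A by (simp add: invariant_sets_def)
  have AI: "indicator A \<in> borel_measurable inv.F"
    using A by (intro borel_measurable_indicator) simp
  have "density P (indicator A) = density P \<phi>"
  proof (rule measure_eqI_cylinder[OF countable_carrier])
    show "finite_measure (density P (indicator A))"
      by (rule finite_measure_restricted) simp
    fix n and x :: "nat \<Rightarrow> 'a" assume x: "\<forall>i\<le>n. x i \<in> carrier G"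
    let ?C = "cylinder G n x"
    have "(\<integral>\<^sup>+\<omega>. indicator ?C \<omega> * indicator A \<omega> \<partial>P) = (\<integral>\<^sup>+\<omega>. indicator ?C \<omega> * \<phi> \<omega> \<partial>P)"
    proof (cases "prob ?C = 0")
      case True
      \<comment> \<open>Null cylinders are set aside because their endpoint might not be
        reachable.\<close>
      then have "AE \<omega> in P. \<omega> \<notin> ?C" by (simp add: prob_eq_0)
      then show ?thesis
        by (intro nn_integral_cong_AE) (auto simp: indicator_def elim!: AE_mp)
    next
      case False
      have "prob ?C \<le> position_prob n (x n)"
        unfolding position_prob_def by (rule finite_measure_mono) (auto simp: cylinder_def)
      then have "0 < position_prob n (x n)"
        using False measure_nonneg[of P ?C] by linarith
      then have xn: "x n \<in> reachable"
        using x by (auto simp: reachable_def)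
      have C: "\<omega> n = x n" if "\<omega> \<in> ?C" for \<omega> using that by (simp add: cylinder_def)
      have "(\<integral>\<^sup>+\<omega>. indicator ?C \<omega> * indicator A \<omega> \<partial>P) =
          emeasure P ?C * (\<integral>\<^sup>+\<omega>. indicator A \<omega> * ennreal (inv.dens (x n) \<omega>) \<partial>P)"
        by (rule inv.nn_integral_past_dens[OF past_cylinder[OF x] _ xn AI]) (rule C)
      also have "(\<integral>\<^sup>+\<omega>. indicator A \<omega> * ennreal (inv.dens (x n) \<omega>) \<partial>P) =
          (\<integral>\<^sup>+\<omega>. ennreal (dens (x n) \<omega>) * indicator A \<omega> \<partial>P)"
        using dens_eq_inv_dens[OF eq xn]
        by (intro nn_integral_cong_AE) (auto simp: mult.commute elim!: AE_mp)
      \<comment> \<open>The density has been replaced by its \<open>J\<close>-measurable version,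
        which may be moved through the conditional expectation given \<open>J\<close>.\<close>
      also have "\<dots> = (\<integral>\<^sup>+\<omega>. ennreal (dens (x n) \<omega>) * \<phi> \<omega> \<partial>P)"
        unfolding \<phi>_def by (rule fs.nn_cond_exp_intg[symmetric]) auto
      also have "\<dots> = (\<integral>\<^sup>+\<omega>. \<phi> \<omega> * ennreal (dens (x n) \<omega>) \<partial>P)"
        by (simp add: mult.commute)
      also have "emeasure P ?C * \<dots> = (\<integral>\<^sup>+\<omega>. indicator ?C \<omega> * \<phi> \<omega> \<partial>P)"
        by (rule nn_integral_past_dens[OF past_cylinder[OF x] _ xn \<phi>, symmetric]) (rule C)
      finally show ?thesis .
    qed
    then show "emeasure (density P (indicator A)) ?C = emeasure (density P \<phi>) ?C"
      by (simp add: emeasure_density measurable_P_eq mult.commute)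
  qed simp_all
  then have AE: "AE \<omega> in P. indicator A \<omega> = \<phi> \<omega>"
    by (subst (asm) density_unique_iff) (auto simp: measurable_P_eq)
  define B where "B = {\<omega> \<in> space F. \<phi> \<omega> = 1}"
  have "B \<in> sets F" unfolding B_def by measurable
  moreover have "AE \<omega> in P. \<omega> \<in> A \<longleftrightarrow> \<omega> \<in> B"
    using AE AE_space by eventually_elim (auto simp: B_def indicator_def split: if_splits)
  ultimately show ?thesis by auto
qed

end

section \<open>Tracking the trajectory\<close>

context walk_field
begin

text \<open>A hit at a time m \<ge> n lies either in the exceptional event \<open>Z n\<close>, where
  the set is too large or the decay has not yet set in, or in some \<open>W n m\<close>. The former
  has vanishing probability; the latter are summed over m as a geometric series.\<close>

lemma prob_tracking_tendsto_0:
  fixes Q :: "nat \<Rightarrow> (nat \<Rightarrow> 'a) \<Rightarrow> 'a set"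
  assumes decay: "AE \<omega> in P. \<forall>\<^sub>F m in sequentially.
      position_prob m (\<omega> m) * dens (\<omega> m) \<omega> \<le> exp (- (c * real m))"
    and c: "0 < c" and \<epsilon>: "\<epsilon> < c"
    and Q: "\<And>n. Q n \<in> measurable F (count_space {A. finite A \<and> A \<subseteq> carrier G})"
    and growth: "AE \<omega> in P. limsup (\<lambda>n. ereal (1 / real n) * log_card (Q n \<omega>)) < ereal \<epsilon>"
  shows "(\<lambda>n. prob {\<omega> \<in> space P. \<exists>m\<ge>n. \<omega> m \<in> Q n \<omega>}) \<longlonglongrightarrow> 0"
proof -
  define q where "q m x \<omega> = position_prob m x * dens x \<omega>" for m x \<omega>
  have q_F[measurable]: "q m x \<in> borel_measurable F" for m x
    unfolding q_def[abs_def] by measurable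
  have q_P[measurable]: "(\<lambda>\<omega>. q m (\<omega> m) \<omega>) \<in> borel_measurable (path_space G)" for m
    by (intro measurable_at_position[of "q m"] measurable_F_P[OF q_F])
  have pred_Q_F[measurable]: "Measurable.pred F (\<lambda>\<omega>. R (Q n \<omega>))" for n R
    by (rule measurable_compose[OF Q]) simp
  have pred_Q_P[measurable]: "Measurable.pred (path_space G) (\<lambda>\<omega>. R (Q n \<omega>))" for n R
    by (rule measurable_F_P[OF pred_Q_F])
  have hit_P[measurable]: "Measurable.pred (path_space G) (\<lambda>\<omega>. \<omega> m \<in> Q n \<omega>)" for n m
    by (rule measurable_at_position[of "\<lambda>x \<omega>. x \<in> Q n \<omega>"]) (rule pred_Q_P)
  have Q_fin: "finite (Q n \<omega>)" "Q n \<omega> \<subseteq> carrier G" if "\<omega> \<in> space (path_space G)" for n \<omega>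
    using measurable_space[OF Q, of \<omega> n] that by auto
  define Z where "Z n = {\<omega> \<in> space P. exp (\<epsilon> * real n) < real (card (Q n \<omega>)) \<or>
      (\<exists>m\<ge>n. exp (- (c * real m)) < q m (\<omega> m) \<omega>)}" for n
  define W where "W n m = {\<omega> \<in> space P. \<omega> m \<in> Q n \<omega> \<and> real (card (Q n \<omega>)) \<le> exp (\<epsilon> * real n) \<and>
      q m (\<omega> m) \<omega> \<le> exp (- (c * real m))}" for n m
  have Z[measurable, simp]: "Z n \<in> sets (path_space G)" for n
    unfolding Z_def space_P by measurable
  have W[measurable, simp]: "W n m \<in> sets (path_space G)" for n m
    unfolding W_def space_P by measurable

  have "AE \<omega> in P. \<forall>\<^sub>F n in sequentially. \<omega> \<notin> Z n"
    using decay growth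
  proof eventually_elim
    case (elim \<omega>)
    have "\<forall>\<^sub>F n in sequentially. real (card (Q n \<omega>)) \<le> exp (\<epsilon> * real n)"
      using Limsup_lessD[OF elim(2)] eventually_gt_at_top[of 0]
    proof eventually_elim
      case (elim n)
      show ?case
      \<comment> \<open>For cardinality 0 the value of \<open>log_card\<close> is -\<infinity>, and
        the bound is trivial.\<close>
      proof (cases "card (Q n \<omega>) = 0")
        case False
        then have "1 / real n * ln (real (card (Q n \<omega>))) < \<epsilon>"
          using elim(1) by (simp add: log_card_def)
        then have "ln (real (card (Q n \<omega>))) < \<epsilon> * real n"
          using elim(2) by (simp add: field_simps)
        then have "exp (ln (real (card (Q n \<omega>)))) < exp (\<epsilon> * real n)" by simp
        then show ?thesis using False by simp
      qed simp
    qed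
    moreover have "\<forall>\<^sub>F n in sequentially. \<forall>m\<ge>n. q m (\<omega> m) \<omega> \<le> exp (- (c * real m))"
      using elim(1) by (simp add: q_def eventually_all_ge_at_top)
    ultimately show ?case
      by eventually_elim (auto simp: Z_def not_less)
  qed
  then have AE_Z: "AE \<omega> in P. (\<lambda>n. indicator (Z n) \<omega> :: real) \<longlonglongrightarrow> 0"
    by eventually_elim (auto intro!: tendsto_eventually elim: eventually_mono)
  have "(\<lambda>n. \<integral>\<omega>. indicator (Z n) \<omega> \<partial>P) \<longlonglongrightarrow> (\<integral>\<omega>. (0 :: real) \<partial>P)"
    by (rule integral_dominated_convergence[where w = "\<lambda>_. 1"]) (use AE_Z in auto)
  then have Z_lim: "(\<lambda>n. prob (Z n)) \<longlonglongrightarrow> 0"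
    using Z by simp

  \<comment> \<open>Given \<open>J\<close> the set \<open>Q n\<close> is fixed: at most exp
    (\<epsilon> n) points, each occupied at time \<open>m\<close> with conditional probability at
    most exp (- c m).\<close>
  have W_bound: "prob (W n m) \<le> exp (\<epsilon> * real n - c * real m)" for n m
  proof -
    define S where "S x = {\<omega> \<in> space F. x \<in> Q n \<omega> \<and> real (card (Q n \<omega>)) \<le> exp (\<epsilon> * real n)}" for x
    define R where "R x = {\<omega> \<in> space F. q m x \<omega> \<le> exp (- (c * real m))}" for x
    have S: "S x \<in> sets F" for x unfolding S_def by measurable
    have R: "R x \<in> sets F" for x unfolding R_def by measurable
    have SP: "S x \<in> sets P" for x using S subalgebra_F by (auto simp: subalgebra_def)
    let ?H = "\<lambda>x \<omega>. indicator (S x \<inter> R x) \<omega> :: ennreal"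
    have "emeasure P (W n m) = (\<integral>\<^sup>+\<omega>. indicator (W n m) \<omega> \<partial>P)"
      by (rule nn_integral_indicator[symmetric]) simp
    also have "\<dots> = (\<integral>\<^sup>+\<omega>. ?H (\<omega> m) \<omega> \<partial>P)"
      by (intro nn_integral_cong) (auto simp: W_def S_def R_def indicator_def)
    also have "\<dots> = (\<integral>\<^sup>+x. ennreal (position_prob m x) * (\<integral>\<^sup>+\<omega>. ?H x \<omega> * ennreal (dens x \<omega>) \<partial>P)
        \<partial>count_space (carrier G))"
      by (rule nn_integral_position) (intro borel_measurable_indicator sets.Int S R)
    also have "\<dots> \<le> (\<integral>\<^sup>+x. (\<integral>\<^sup>+\<omega>. ennreal (exp (- (c * real m))) * indicator (S x) \<omega> \<partial>P)
        \<partial>count_space (carrier G))"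
    proof (rule nn_integral_mono)
      fix x
      have [measurable]: "S x \<in> sets P" "R x \<in> sets P"
        using S[of x] R[of x] subalgebra_F by (auto simp: subalgebra_def)
      have "ennreal (position_prob m x) * (\<integral>\<^sup>+\<omega>. ?H x \<omega> * ennreal (dens x \<omega>) \<partial>P) =
          (\<integral>\<^sup>+\<omega>. ennreal (position_prob m x) * (?H x \<omega> * ennreal (dens x \<omega>)) \<partial>P)"
        by (rule nn_integral_cmult[symmetric]) (auto simp: measurable_P_eq)
      also have "\<dots> \<le> (\<integral>\<^sup>+\<omega>. ennreal (exp (- (c * real m))) * indicator (S x) \<omega> \<partial>P)"
      proof (rule nn_integral_mono)
        fix \<omega>
        have "ennreal (position_prob m x) * ennreal (dens x \<omega>) = ennreal (q m x \<omega>)"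
          by (simp add: q_def ennreal_mult position_prob_nonneg dens_nonneg)
        then show "ennreal (position_prob m x) * (?H x \<omega> * ennreal (dens x \<omega>)) \<le>
            ennreal (exp (- (c * real m))) * indicator (S x) \<omega>"
          by (auto simp: indicator_def R_def intro: ennreal_leI)
      qed
      finally show "ennreal (position_prob m x) * (\<integral>\<^sup>+\<omega>. ?H x \<omega> * ennreal (dens x \<omega>) \<partial>P) \<le>
          (\<integral>\<^sup>+\<omega>. ennreal (exp (- (c * real m))) * indicator (S x) \<omega> \<partial>P)" .
    qed
    \<comment> \<open>After the exchange the inner sum counts the points of
      \<open>Q n \<omega>\<close> if that set is small, and is 0 otherwise.\<close>
    also have "\<dots> = (\<integral>\<^sup>+\<omega>. (\<integral>\<^sup>+x. ennreal (exp (- (c * real m))) * indicator (S x) \<omega>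
        \<partial>count_space (carrier G)) \<partial>P)"
      using SP by (intro nn_integral_count_space_nn_integral[symmetric] countable_carrier)
        (auto intro!: borel_measurable_times borel_measurable_indicator)
    also have "\<dots> \<le> (\<integral>\<^sup>+\<omega>. ennreal (exp (\<epsilon> * real n - c * real m)) \<partial>P)"
    proof (rule nn_integral_mono)
      fix \<omega> assume "\<omega> \<in> space P"
      then have \<omega>: "\<omega> \<in> space (path_space G)" by simp
      have "(\<integral>\<^sup>+x. indicator (S x) \<omega> \<partial>count_space (carrier G)) \<le> ennreal (exp (\<epsilon> * real n))"
      proof (cases "real (card (Q n \<omega>)) \<le> exp (\<epsilon> * real n)")
        case True
        have "(\<integral>\<^sup>+x. indicator (S x) \<omega> \<partial>count_space (carrier G)) =
            (\<integral>\<^sup>+x. indicator (Q n \<omega>) x \<partial>count_space (carrier G))"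
          using True \<omega> by (intro nn_integral_cong) (auto simp: S_def indicator_def)
        also have "\<dots> = ennreal (real (card (Q n \<omega>)))"
          using Q_fin[OF \<omega>] by (simp add: emeasure_count_space_finite ennreal_of_nat_eq_real_of_nat)
        also have "\<dots> \<le> ennreal (exp (\<epsilon> * real n))" using True by (rule ennreal_leI)
        finally show ?thesis .
      next
        case False
        then have "(\<integral>\<^sup>+x. indicator (S x) \<omega> \<partial>count_space (carrier G)) =
            (\<integral>\<^sup>+x. 0 \<partial>count_space (carrier G))"
          by (intro nn_integral_cong) (auto simp: S_def indicator_def)
        then show ?thesis by simp
      qed
      then have "ennreal (exp (- (c * real m))) * (\<integral>\<^sup>+x. indicator (S x) \<omega> \<partial>count_space (carrier G))
          \<le> ennreal (exp (- (c * real m))) * ennreal (exp (\<epsilon> * real n))"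
        by (rule mult_left_mono) simp
      also have "\<dots> = ennreal (exp (\<epsilon> * real n - c * real m))"
        by (simp flip: ennreal_mult exp_add)
      finally show "(\<integral>\<^sup>+x. ennreal (exp (- (c * real m))) * indicator (S x) \<omega> \<partial>count_space (carrier G))
          \<le> ennreal (exp (\<epsilon> * real n - c * real m))"
        by (subst nn_integral_cmult) auto
    qed
    also have "\<dots> = ennreal (exp (\<epsilon> * real n - c * real m))"
      using emeasure_space_1 by simp
    finally show ?thesis
      by (simp add: emeasure_eq_measure)
  qed

  have bound: "prob {\<omega> \<in> space P. \<exists>m\<ge>n. \<omega> m \<in> Q n \<omega>} \<le>
      prob (Z n) + exp (- (c - \<epsilon>)) ^ n * (1 / (1 - exp (- c)))" (is "prob ?B \<le> _") for n
  proof -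
    \<comment> \<open>Writing m = n + j separates a factor that vanishes as n grows, since
      \<epsilon> < c, from a geometric series in j, convergent since c > 0.\<close>
    have exp_eq: "exp (\<epsilon> * real n - c * real (n + j)) = exp (- (c - \<epsilon>)) ^ n * exp (- c) ^ j" for j
      by (simp add: algebra_simps flip: exp_of_nat_mult exp_add)
    have le: "prob (W n (n + j)) \<le> exp (- (c - \<epsilon>)) ^ n * exp (- c) ^ j" for j
      using W_bound[of n "n + j"] unfolding exp_eq .
    have sums: "(\<lambda>j. exp (- (c - \<epsilon>)) ^ n * exp (- c) ^ j) sums (exp (- (c - \<epsilon>)) ^ n * (1 / (1 - exp (- c))))"
      using c by (intro sums_mult geometric_sums) simp
    have summ: "summable (\<lambda>j. prob (W n (n + j)))"
      by (rule summable_comparison_test'[OF sums_summable[OF sums], of 0]) (use le in simp)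
    have "?B \<subseteq> Z n \<union> (\<Union>j. W n (n + j))"
    proof
      fix \<omega> assume "\<omega> \<in> ?B"
      then obtain m where m: "n \<le> m" "\<omega> m \<in> Q n \<omega>" "\<omega> \<in> space P" by blast
      then show "\<omega> \<in> Z n \<union> (\<Union>j. W n (n + j))"
        using le_add_diff_inverse[OF m(1)]
        by (cases "\<omega> \<in> Z n") (auto simp: Z_def W_def not_less intro!: exI[of _ "m - n"])
    qed
    then have "prob ?B \<le> prob (Z n \<union> (\<Union>j. W n (n + j)))"
      by (rule finite_measure_mono) auto
    also have "\<dots> \<le> prob (Z n) + prob (\<Union>j. W n (n + j))"
      by (rule measure_Un_le) auto
    also have "prob (\<Union>j. W n (n + j)) \<le> (\<Sum>j. prob (W n (n + j)))"
      by (rule finite_measure_subadditive_countably[OF _ summ]) auto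
    also have "\<dots> \<le> (\<Sum>j. exp (- (c - \<epsilon>)) ^ n * exp (- c) ^ j)"
      by (rule suminf_le[OF le summ sums_summable[OF sums]])
    also have "\<dots> = exp (- (c - \<epsilon>)) ^ n * (1 / (1 - exp (- c)))"
      using sums by (rule sums_unique[symmetric])
    finally show ?thesis by simp
  qed
  have "(\<lambda>n. prob (Z n) + exp (- (c - \<epsilon>)) ^ n * (1 / (1 - exp (- c)))) \<longlonglongrightarrow> 0 + 0 * (1 / (1 - exp (- c)))"
    using \<epsilon> by (intro tendsto_add Z_lim tendsto_mult_right LIMSEQ_realpow_zero) auto
  then have lim: "(\<lambda>n. prob (Z n) + exp (- (c - \<epsilon>)) ^ n * (1 / (1 - exp (- c)))) \<longlonglongrightarrow> 0" by simp
  show ?thesis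
    by (rule tendsto_sandwich[OF _ _ tendsto_const lim]) (use bound in auto)
qed

end

section \<open>From tracking sets to equality of the completed fields\<close>

theorem corollary2p3:
  fixes G :: "('a, 'b) monoid_scheme"
    and \<mu> :: "'a pmf"
    and P :: "(nat \<Rightarrow> 'a) measure"
    and J :: "(nat \<Rightarrow> 'a) set set"
  assumes "group G"
    and "countable (carrier G)"
    and "infinite (carrier G)"
    and "set_pmf \<mu> \<subseteq> carrier G"
    and "generate G (set_pmf \<mu>) = carrier G"
    and "random_walk_law G \<mu> P"
    and "pmf_entropy \<mu> < \<infinity>"
    and "sigma_algebra (space (path_space G)) J"
    and "J \<subseteq> invariant_sets G"
    and "group_closed G J"
    and "\<And>\<epsilon>::real. \<epsilon> > 0 \<Longrightarrow>
      \<exists>Q :: nat \<Rightarrow> (nat \<Rightarrow> 'a) \<Rightarrow> 'a set.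
        (\<forall>n. Q n \<in> measurable (sigma (space (path_space G)) J)
                     (count_space {F. finite F \<and> F \<subseteq> carrier G})) \<and>
        (AE \<omega> in P. limsup (\<lambda>n. ereal (1 / real n) * log_card (Q n \<omega>)) < ereal \<epsilon>) \<and>
        limsup (\<lambda>n. ereal (measure P {\<omega> \<in> space P. \<exists>m\<ge>n. \<omega> m \<in> Q n \<omega>})) > 0"
  shows "equal_mod0 P J (invariant_sets G)"
proof -
  interpret walk_field G \<mu> P J
    by (intro walk_field.intro random_walk.intro random_walk_axioms.intro walk_field_axioms.intro assms)
  have eq: "AE \<omega> in P. step_ratio \<omega> = 1"
  proof (rule ccontr)
    assume "\<not> (AE \<omega> in P. step_ratio \<omega> = 1)"
    then obtain c where c: "0 < c" and decay: "AE \<omega> in P. \<forall>\<^sub>F m in sequentially.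
        position_prob m (\<omega> m) * dens (\<omega> m) \<omega> \<le> exp (- (c * real m))"
      using conditional_prob_decay by blast
    \<comment> \<open>The growth rate of the tracking sets is chosen strictly below the decay rate
      \<open>c\<close>.\<close>
    have "0 < c / 2" using c by simp
    from assms(11)[OF this] obtain Q :: "nat \<Rightarrow> (nat \<Rightarrow> 'a) \<Rightarrow> 'a set" where
      Q: "\<And>n. Q n \<in> measurable F (count_space {A. finite A \<and> A \<subseteq> carrier G})"
        "AE \<omega> in P. limsup (\<lambda>n. ereal (1 / real n) * log_card (Q n \<omega>)) < ereal (c / 2)"
        "limsup (\<lambda>n. ereal (prob {\<omega> \<in> space P. \<exists>m\<ge>n. \<omega> m \<in> Q n \<omega>})) > 0"
      unfolding F_def by blast
    have "(\<lambda>n. prob {\<omega> \<in> space P. \<exists>m\<ge>n. \<omega> m \<in> Q n \<omega>}) \<longlonglongrightarrow> 0"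
      using c by (intro prob_tracking_tendsto_0[OF decay _ _ Q(1,2)]) auto
    then have "(\<lambda>n. ereal (prob {\<omega> \<in> space P. \<exists>m\<ge>n. \<omega> m \<in> Q n \<omega>})) \<longlonglongrightarrow> ereal 0"
      by (rule tendsto_ereal)
    then have "limsup (\<lambda>n. ereal (prob {\<omega> \<in> space P. \<exists>m\<ge>n. \<omega> m \<in> Q n \<omega>})) = ereal 0"
      by (rule lim_imp_Limsup[OF sequentially_bot])
    then show False using Q(3) by simp
  qed
  let ?N = "null_sets (completion P)"
  have "invariant_sets G \<subseteq> sigma_sets (space P) (J \<union> ?N)"
  proof
    fix A assume A: "A \<in> invariant_sets G"
    then obtain B where B: "B \<in> J" and AB: "AE \<omega> in P. \<omega> \<in> A \<longleftrightarrow> \<omega> \<in> B"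
      using invariant_set_approx[OF eq] by blast
    have AP: "A \<in> sets P" and BP: "B \<in> sets P"
      using A B assms(9) by (auto simp: invariant_sets_def)
    have sub: "A \<subseteq> space P" "B \<subseteq> space P"
      using sets.sets_into_space[OF AP] sets.sets_into_space[OF BP] by auto
    \<comment> \<open>Both differences are null, so \<open>A\<close> is recovered from
      \<open>B\<close> by removing one null set and adding another.\<close>
    have "A - B \<in> null_sets P" "B - A \<in> null_sets P"
      using AB AP BP by (auto simp: AE_iff_null_sets elim!: AE_mp)
    then have N: "A - B \<in> ?N" "B - A \<in> ?N"
      by (auto intro: null_sets_completionI)
    interpret S: sigma_algebra "space P" "sigma_sets (space P) (J \<union> ?N)"
    proof (rule sigma_algebra_sigma_sets)
      show "J \<union> ?N \<subseteq> Pow (space P)"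
        using assms(9) sets.sets_into_space[of _ P] sets.sets_into_space[of _ "completion P"]
        by (auto simp: invariant_sets_def null_sets_def)
    qed
    have "B \<in> sigma_sets (space P) (J \<union> ?N)" "A - B \<in> sigma_sets (space P) (J \<union> ?N)"
        "B - A \<in> sigma_sets (space P) (J \<union> ?N)"
      using B N by (blast intro: sigma_sets.Basic)+
    then have "B - (B - A) \<union> (A - B) \<in> sigma_sets (space P) (J \<union> ?N)"
      by (intro S.Un S.Diff[of B "B - A"])
    moreover have "B - (B - A) \<union> (A - B) = A" by blast
    ultimately show "A \<in> sigma_sets (space P) (J \<union> ?N)" by simp
  qed
  then have "sigma_sets (space P) (invariant_sets G \<union> ?N) \<subseteq> sigma_sets (space P) (J \<union> ?N)"
    by (intro sigma_sets_mono) (auto intro: sigma_sets.Basic)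
  moreover have "sigma_sets (space P) (J \<union> ?N) \<subseteq> sigma_sets (space P) (invariant_sets G \<union> ?N)"
    by (intro sigma_sets_mono') (use assms(9) in blast)
  ultimately show ?thesis
    by (auto simp: equal_mod0_def completed_sets_def)
qed

end
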